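(* Let $Y(x)=x_1-\alpha x_2$, $n=\nabla Y=(1,-\alpha)$, $|n|=\sqrt{1+\alpha^2}$, and $q(x)=n^\top a(x)n=a_{11}(x)-2\alpha a_{12}(x)+\alpha^2a_{22}(x)$. Then, as signed measures on $(0,\infty)^2$, the stopping gain $\Gamma=c+rG-\mathcal LG$ satisfies $$\Gamma=\Gamma^{\mathrm{ac}}\,dx+\Gamma^\Delta,\qquad \Gamma^\Delta(dx)=-\frac{q(x)}{2\sqrt{1+\alpha^2}}\,\sigma_\Delta(dx),$$ where $\sigma_\Delta$ is arc-length measure on $\Delta=\{x_1=\alpha x_2\}$. Equivalently, for bounded Borel $F$ (for which the integrals are defined), $$\int F\,d\Gamma^\Delta=-\frac{1}{2\sqrt{1+\alpha^2}}\int_\Delta F(x)\,q(x)\,\sigma_\Delta(dx).$$ Since $a\succeq 0$, one has $q\ge 0$, so $\Gamma^\Delta\le 0$; and if $a$ is non-degenerate at $x\in\Delta$, then $q(x)>0$ and $\Gamma^\Delta$ is strictly negative there (i.e. its density with respect to $\sigma_\Delta$ is strictly negative at $x$).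
   Context: Let $\mathbb R^2_+=[0,\infty)^2$, $\alpha>0$, $r>0$, and $G(x_1,x_2)=x_1\vee\alpha x_2$. The running cost $c:\mathbb R^2_+\to[0,\infty)$ is continuous. The coefficients $\mu:\mathbb R^2_+\to\mathbb R^2$ and $\sigma:\mathbb R^2_+\to\mathbb R^{2\times 2}$ are locally Lipschitz with at most linear growth, $a=\sigma\sigma^\top$, and $a$ is locally uniformly elliptic on $\mathbb R^2_+$ (for every compact $K\subset\mathbb R^2_+$ there is $\lambda_K>0$ with $\xi^\top a(x)\xi\ge\lambda_K|\xi|^2$ for $x\in K$, $\xi\in\mathbb R^2$). The interior generator is $\mathcal Lf=\sum_{i=1}^2\mu_i\partial_if+\frac12\sum_{i,j=1}^2a_{ij}\partial_{ij}f$. $\mathcal LG$ is understood in the distributional sense on $(0,\infty)^2$: the distributional first derivatives of $G$ are bounded functions and its distributional second derivatives are signed Radon measures, multiplied by the continuous coefficients $\mu_i$ and $\frac12a_{ij}$. So $\Gamma=c+rG-\mathcal LG$ is a signed Radon measure (functions being identified with densities against Lebesgue measure $dx$). On $\mathcal R_1=\{x_1>\alpha x_2\}$, $G=x_1$, and on $\mathcal R_2=\{x_1<\alpha x_2\}$, $G=\alpha x_2$. The absolutely continuous part is defined off $\Delta$ by applying $\mathcal L$ to $G$ in the classical sense on each region: $\Gamma^{\mathrm{ac}}=c+rx_1-\mu_1$ on $\mathcal R_1$ and $\Gamma^{\mathrm{ac}}=c+r\alpha x_2-\alpha\mu_2$ on $\mathcal R_2$. *)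

theory Defs
  imports "HOL-Analysis.Analysis"
begin

definition clq :: "(real^2) set" where
  "clq = {x. 0 \<le> x$1 \<and> 0 \<le> x$2}"

definition opq :: "(real^2) set" where
  "opq = {x. 0 < x$1 \<and> 0 < x$2}"


text \<open>Partial derivatives, smooth functions and test functions. A function is \<open>C\<^sup>\<infinity>\<close> iff all its
  iterated partial derivatives exist and are differentiable.\<close>

definition partial :: "2 \<Rightarrow> (real^2 \<Rightarrow> real) \<Rightarrow> real^2 \<Rightarrow> real" where
  "partial i f x = deriv (\<lambda>t. f (x + t *\<^sub>R axis i 1)) 0"

definition smooth_fun :: "(real^2 \<Rightarrow> real) \<Rightarrow> bool" where
  "smooth_fun f \<longleftrightarrow> (\<forall>is. foldr partial is f differentiable_on UNIV)"

definition test_fun :: "(real^2 \<Rightarrow> real) \<Rightarrow> bool" where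
  "test_fun \<phi> \<longleftrightarrow> smooth_fun \<phi> \<and> (\<exists>K. compact K \<and> K \<subseteq> opq \<and> (\<forall>x. x \<notin> K \<longrightarrow> \<phi> x = 0))"


text \<open>Signed Radon measures on the open quadrant. Both the positive and the negative part may have
  infinite total mass, so such an object is a set function on relatively compact Borel sets that is a
  difference of two locally finite Borel measures. It is given the value 0 on all other sets, so that
  equality of signed Radon measures is equality of functions.\<close>

definition rel_compact :: "(real^2) set set" where
  "rel_compact = {A \<in> sets borel. \<exists>K. compact K \<and> A \<subseteq> K \<and> K \<subseteq> opq}"

definition radon :: "(real^2) measure \<Rightarrow> bool" where
  "radon M \<longleftrightarrow> sets M = sets (restrict_space borel opq) \<and>
     (\<forall>K. compact K \<and> K \<subseteq> opq \<longrightarrow> emeasure M K < \<infinity>)"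

definition sr_rep :: "((real^2) set \<Rightarrow> real) \<Rightarrow> (real^2) measure \<Rightarrow> (real^2) measure \<Rightarrow> bool" where
  "sr_rep \<nu> P N \<longleftrightarrow> radon P \<and> radon N \<and>
     (\<forall>A. \<nu> A = (if A \<in> rel_compact then measure P A - measure N A else 0))"

definition signed_radon :: "((real^2) set \<Rightarrow> real) \<Rightarrow> bool" where
  "signed_radon \<nu> \<longleftrightarrow> (\<exists>P N. sr_rep \<nu> P N)"

text \<open>The value of the integral does not depend on the decomposition, and a decomposition as required
  exists iff \<open>F\<close> is integrable with respect to the total variation of \<open>\<nu>\<close>.\<close>

definition has_sr_integral :: "((real^2) set \<Rightarrow> real) \<Rightarrow> (real^2 \<Rightarrow> real) \<Rightarrow> real \<Rightarrow> bool" where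
  "has_sr_integral \<nu> F I \<longleftrightarrow> (\<exists>P N. sr_rep \<nu> P N \<and> integrable P F \<and> integrable N F \<and>
     I = (LINT x|P. F x) - (LINT x|N. F x))"

definition sr_integrable :: "((real^2) set \<Rightarrow> real) \<Rightarrow> (real^2 \<Rightarrow> real) \<Rightarrow> bool" where
  "sr_integrable \<nu> F \<longleftrightarrow> (\<exists>I. has_sr_integral \<nu> F I)"

definition sr_integral :: "((real^2) set \<Rightarrow> real) \<Rightarrow> (real^2 \<Rightarrow> real) \<Rightarrow> real" where
  "sr_integral \<nu> F = (THE I. has_sr_integral \<nu> F I)"

definition sr_of :: "(real^2) measure \<Rightarrow> (real^2) set \<Rightarrow> real" where
  "sr_of M A = (if A \<in> rel_compact then measure M A else 0)"

text \<open>The signed measure \<open>h(x) \<nu>(dx)\<close>.\<close>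

definition sr_scale :: "(real^2 \<Rightarrow> real) \<Rightarrow> ((real^2) set \<Rightarrow> real) \<Rightarrow> (real^2) set \<Rightarrow> real" where
  "sr_scale h \<nu> A = (if A \<in> rel_compact then sr_integral \<nu> (\<lambda>x. indicator A x * h x) else 0)"

definition leb :: "(real^2) measure" where
  "leb = restrict_space lborel opq"


text \<open>Distributional derivatives on the open quadrant.\<close>

definition bounded_weak_partial :: "2 \<Rightarrow> (real^2 \<Rightarrow> real) \<Rightarrow> (real^2 \<Rightarrow> real) \<Rightarrow> bool" where
  "bounded_weak_partial i f g \<longleftrightarrow>
     g \<in> borel_measurable (restrict_space borel opq) \<and> bounded (g ` opq) \<and>
     (\<forall>\<phi>. test_fun \<phi> \<longrightarrow> (LINT x|leb. g x * \<phi> x) = - (LINT x|leb. f x * partial i \<phi> x))"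

definition measure_second_partial ::
  "2 \<Rightarrow> 2 \<Rightarrow> (real^2 \<Rightarrow> real) \<Rightarrow> ((real^2) set \<Rightarrow> real) \<Rightarrow> bool" where
  "measure_second_partial i j f \<nu> \<longleftrightarrow> signed_radon \<nu> \<and>
     (\<forall>\<phi>. test_fun \<phi> \<longrightarrow> sr_integral \<nu> \<phi> = (LINT x|leb. f x * partial i (partial j \<phi>) x))"


definition loc_lipschitz_on :: "'a::metric_space set \<Rightarrow> ('a \<Rightarrow> 'b::metric_space) \<Rightarrow> bool" where
  "loc_lipschitz_on X f \<longleftrightarrow> local_lipschitz (UNIV :: real set) X (\<lambda>_. f)"

definition linear_growth_on ::
  "'a::real_normed_vector set \<Rightarrow> ('a \<Rightarrow> 'b::real_normed_vector) \<Rightarrow> bool" where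
  "linear_growth_on X f \<longleftrightarrow> (\<exists>C. \<forall>x\<in>X. norm (f x) \<le> C * (1 + norm x))"

definition diffusion :: "(real^2 \<Rightarrow> real^2^2) \<Rightarrow> real^2 \<Rightarrow> real^2^2" where
  "diffusion \<sigma> x = \<sigma> x ** transpose (\<sigma> x)"

definition loc_unif_elliptic :: "(real^2) set \<Rightarrow> (real^2 \<Rightarrow> real^2^2) \<Rightarrow> bool" where
  "loc_unif_elliptic X a \<longleftrightarrow>
     (\<forall>K. compact K \<and> K \<subseteq> X \<longrightarrow> (\<exists>l>0. \<forall>x\<in>K. \<forall>\<xi>. \<xi> \<bullet> (a x *v \<xi>) \<ge> l * (norm \<xi>)\<^sup>2))"

definition reward :: "real \<Rightarrow> real^2 \<Rightarrow> real" where
  "reward \<alpha> x = max (x$1) (\<alpha> * x$2)"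

definition generator ::
  "(real^2 \<Rightarrow> real^2) \<Rightarrow> (real^2 \<Rightarrow> real^2^2) \<Rightarrow> (real^2 \<Rightarrow> real) \<Rightarrow> real^2 \<Rightarrow> real" where
  "generator \<mu> \<sigma> f x = (\<Sum>i\<in>UNIV. \<mu> x $ i * partial i f x) +
     1/2 * (\<Sum>i\<in>UNIV. \<Sum>j\<in>UNIV. diffusion \<sigma> x $ i $ j * partial i (partial j f) x)"

text \<open>\<open>\<L>f\<close> in the distributional sense, for \<open>f\<close> whose distributional first derivatives are bounded
  functions and whose distributional second derivatives are signed Radon measures.\<close>

definition is_distr_generator ::
  "(real^2 \<Rightarrow> real^2) \<Rightarrow> (real^2 \<Rightarrow> real^2^2) \<Rightarrow> (real^2 \<Rightarrow> real) \<Rightarrow> ((real^2) set \<Rightarrow> real) \<Rightarrow> bool" where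
  "is_distr_generator \<mu> \<sigma> f \<Lambda> \<longleftrightarrow>
     (\<exists>g \<nu>. (\<forall>i. bounded_weak_partial i f (g i)) \<and> (\<forall>i j. measure_second_partial i j f (\<nu> i j)) \<and>
        (\<forall>A. \<Lambda> A = (\<Sum>i\<in>UNIV. sr_scale (\<lambda>x. \<mu> x $ i * g i x) (sr_of leb) A) +
           (\<Sum>i\<in>UNIV. \<Sum>j\<in>UNIV. sr_scale (\<lambda>x. 1/2 * diffusion \<sigma> x $ i $ j) (\<nu> i j) A)))"

definition distr_generator ::
  "(real^2 \<Rightarrow> real^2) \<Rightarrow> (real^2 \<Rightarrow> real^2^2) \<Rightarrow> (real^2 \<Rightarrow> real) \<Rightarrow> (real^2) set \<Rightarrow> real" where
  "distr_generator \<mu> \<sigma> f = (THE \<Lambda>. is_distr_generator \<mu> \<sigma> f \<Lambda>)"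

definition stopping_gain :: "real \<Rightarrow> real \<Rightarrow> (real^2 \<Rightarrow> real) \<Rightarrow> (real^2 \<Rightarrow> real^2) \<Rightarrow>
    (real^2 \<Rightarrow> real^2^2) \<Rightarrow> (real^2) set \<Rightarrow> real" where
  "stopping_gain \<alpha> r c \<mu> \<sigma> A =
     sr_scale (\<lambda>x. c x + r * reward \<alpha> x) (sr_of leb) A - distr_generator \<mu> \<sigma> (reward \<alpha>) A"

definition diagonal :: "real \<Rightarrow> (real^2) set" where
  "diagonal \<alpha> = {x. x$1 = \<alpha> * x$2}"

text \<open>The value 0 on the Lebesgue null set \<open>\<Delta>\<close> is arbitrary.\<close>

definition gamma_ac :: "real \<Rightarrow> real \<Rightarrow> (real^2 \<Rightarrow> real) \<Rightarrow> (real^2 \<Rightarrow> real^2) \<Rightarrow>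
    (real^2 \<Rightarrow> real^2^2) \<Rightarrow> real^2 \<Rightarrow> real" where
  "gamma_ac \<alpha> r c \<mu> \<sigma> x = (if x \<in> diagonal \<alpha> then 0
     else c x + r * reward \<alpha> x - generator \<mu> \<sigma> (reward \<alpha>) x)"

definition lin_Y :: "real \<Rightarrow> real^2 \<Rightarrow> real" where
  "lin_Y \<alpha> x = x$1 - \<alpha> * x$2"

definition normal_vec :: "real \<Rightarrow> real^2" where
  "normal_vec \<alpha> = vector [1, - \<alpha>]"

definition q_form :: "real \<Rightarrow> (real^2 \<Rightarrow> real^2^2) \<Rightarrow> real^2 \<Rightarrow> real" where
  "q_form \<alpha> \<sigma> x = normal_vec \<alpha> \<bullet> (diffusion \<sigma> x *v normal_vec \<alpha>)"

text \<open>Arc-length measure on the part of \<open>\<Delta>\<close> in the open quadrant: the image of Lebesgue measure on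
  \<open>(0,\<infinity>)\<close> under the unit-speed parametrization of this half-line.\<close>

definition arc_length :: "real \<Rightarrow> (real^2) measure" where
  "arc_length \<alpha> = distr (restrict_space lborel {0<..}) (restrict_space borel opq)
     (\<lambda>t. (t / sqrt (1 + \<alpha>\<^sup>2)) *\<^sub>R vector [\<alpha>, 1])"


text \<open>The explicit form of \<open>gamma_ac\<close> on the two regions.\<close>

lemma partial_cong_open:
  assumes "open S" "x \<in> S" "\<And>y. y \<in> S \<Longrightarrow> f y = g y"
  shows "partial i f x = partial i g x"
proof -
  have "((\<lambda>t::real. x + t *\<^sub>R axis i 1) \<longlongrightarrow> x + 0 *\<^sub>R axis i 1) (nhds 0)"
    by (intro tendsto_intros filterlim_ident)
  then have "eventually (\<lambda>t::real. x + t *\<^sub>R axis i 1 \<in> S) (nhds 0)"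
    using assms(1,2) by (auto simp: tendsto_def)
  then have "eventually (\<lambda>t::real. f (x + t *\<^sub>R axis i 1) = g (x + t *\<^sub>R axis i 1)) (nhds 0)"
    by eventually_elim (use assms(3) in auto)
  then show ?thesis
    unfolding partial_def by (rule deriv_cong_ev) simp
qed

lemma partial_coord: "partial i (\<lambda>x. k * x $ j) x = (if i = j then k else 0)"
proof -
  have "((\<lambda>t::real. k * (x + t *\<^sub>R axis i 1) $ j) has_field_derivative (if i = j then k else 0)) (at 0)"
    by (auto intro!: derivative_eq_intros simp: axis_def)
  then show ?thesis
    unfolding partial_def by (rule DERIV_imp_deriv)
qed

lemma partial_const: "partial i (\<lambda>x. k) x = 0"
  unfolding partial_def by simp

lemma generator_locally_coord:
  assumes "open S" "x \<in> S" "\<And>y. y \<in> S \<Longrightarrow> f y = k * y $ l"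
  shows "generator \<mu> \<sigma> f x = \<mu> x $ l * k"
proof -
  have 1: "partial i f y = (if i = l then k else 0)" if "y \<in> S" for i y
    using partial_cong_open[OF assms(1) that assms(3)] by (simp add: partial_coord)
  have 2: "partial i (partial j f) x = 0" for i j
    using partial_cong_open[OF assms(1,2) 1] by (simp add: partial_const)
  show ?thesis
    unfolding generator_def by (simp add: 1[OF assms(2)] 2 if_distrib cong: if_cong)
qed

lemma gamma_ac_R1:
  assumes "x$1 > \<alpha> * x$2"
  shows "gamma_ac \<alpha> r c \<mu> \<sigma> x = c x + r * x$1 - \<mu> x $ 1"
proof -
  have "open {y::real^2. y$1 > \<alpha> * y$2}"
    by (intro open_Collect_less continuous_intros)
  from generator_locally_coord[OF this, of x "reward \<alpha>" 1 1 \<mu> \<sigma>] show ?thesis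
    using assms by (simp add: gamma_ac_def diagonal_def reward_def)
qed

lemma gamma_ac_R2:
  assumes "x$1 < \<alpha> * x$2"
  shows "gamma_ac \<alpha> r c \<mu> \<sigma> x = c x + r * \<alpha> * x$2 - \<alpha> * \<mu> x $ 2"
proof -
  have "open {y::real^2. y$1 < \<alpha> * y$2}"
    by (intro open_Collect_less continuous_intros)
  from generator_locally_coord[OF this, of x "reward \<alpha>" \<alpha> 2 \<mu> \<sigma>] show ?thesis
    using assms by (simp add: gamma_ac_def diagonal_def reward_def)
qed

end

theory Submission
  imports Defs
begin

text \<open>On lines parallel to an axis, the reward and its gradient are piecewise linear and piecewise
  constant, so integrating by parts against a test function along such lines gives the distributional
  derivatives: the gradient jumps by the normal \<open>n = (1, -\<alpha>)\<close> across \<open>\<Delta>\<close>, hence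
  \<open>\<partial>\<^sub>i\<partial>\<^sub>jG\<close> is \<open>n\<^sub>i n\<^sub>j / \<bar>n\<bar>\<close> times arc length on \<open>\<Delta>\<close>, and contracting with \<open>a/2\<close> produces
  \<open>q / (2\<bar>n\<bar>)\<close>. The distributional generator is well defined because a signed Radon measure is
  determined by its values on test functions: smooth bumps increase to the indicator of an open box,
  and boxes form a generator of the Borel sets that is stable under intersection.\<close>

subsection \<open>Smooth bump functions\<close>

text \<open>Both parts of a signed Radon measure may have infinite mass, and nothing in
  \<open>signed_radon\<close> selects a decomposition. Every comparison of signed measures is
  therefore turned into an equality of positive measures: \<open>P - N\<close> and
  \<open>P' - N'\<close> are compared through the sums \<open>P + N'\<close> and
  \<open>P' + N\<close>, which can be tested on relatively compact sets, where all terms are finite.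
  The \<open>THE\<close> in \<open>distr_generator\<close> demands uniqueness among all admissible
  \<open>g\<close> and \<open>\<nu>\<close>. A weak gradient is fixed only almost everywhere, so it
  is the measures with density \<open>g i\<close> that are identified; multiplication by \<mu> then
  follows from associativity of multiplication by densities. The constant 1 / |n| is a change of
  parameter: the jumps along coordinate lines produce integrals over \<Delta> with respect to dx_2,
  while arc length is sqrt (1 + \<alpha>^2) dx_2 = |n| dx_2. The sign of the singular part reflects
  convexity of G: its second derivatives form a nonnegative matrix-valued measure, and \<Gamma>
  contains minus the generator.\<close>

definition flat_exp :: "real poly \<Rightarrow> real \<Rightarrow> real" where
  "flat_exp p t = (if 0 < t then poly p (1 / t) * exp (- (1 / t)) else 0)"

lemma poly_exp_minus_at_top: "((\<lambda>s::real. poly p s * exp (- s)) \<longlongrightarrow> 0) at_top"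
proof -
  have "((\<lambda>s::real. \<Sum>i\<le>degree p. coeff p i * (s ^ i / exp s)) \<longlongrightarrow> (\<Sum>i\<le>degree p. coeff p i * 0)) at_top"
    by (intro tendsto_intros tendsto_power_div_exp_0)
  then show ?thesis
    by (simp add: poly_altdef exp_minus sum_distrib_right divide_inverse mult.assoc)
qed

text \<open>Because \<open>flat_exp p 0 = 0\<close>, this quotient is the difference quotient at 0,
  the one point where the two defining formulas meet. From the right the factor 1 / t is absorbed by
  multiplying \<open>p\<close> with the monomial \<open>[:0, 1:]\<close>, so only decay at infinity
  in s = 1 / t is needed.\<close>

lemma flat_exp_quotient_tendsto: "((\<lambda>t. flat_exp p t / t) \<longlongrightarrow> 0) (at 0)"
proof -
  have "((\<lambda>t. poly (p * [:0, 1:]) (inverse t) * exp (- inverse t)) \<longlongrightarrow> 0) (at_right 0)"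
    by (rule filterlim_compose[OF poly_exp_minus_at_top filterlim_inverse_at_top_right])
  then have r: "((\<lambda>t. flat_exp p t / t) \<longlongrightarrow> 0) (at_right 0)"
    by (rule Lim_transform_eventually)
      (auto simp: flat_exp_def eventually_at_right_less field_simps intro!: eventually_at_rightI[of 0 1])
  have l: "((\<lambda>t. flat_exp p t / t) \<longlongrightarrow> 0) (at_left 0)"
    by (rule Lim_transform_eventually[OF tendsto_const])
      (auto simp: flat_exp_def intro!: eventually_at_leftI[of "-1"])
  show ?thesis
    using l r by (simp add: filterlim_split_at)
qed

text \<open>The reason for carrying a polynomial: with s = 1 / t one has ds/dt = - s^2, so
  differentiating p(s) exp(-s) gives s^2 (p - p')(s) exp(-s), again of the same form. A single
  derivative rule thus yields all orders.\<close>

lemma flat_exp_has_derivative: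
  "(flat_exp p has_field_derivative flat_exp ([:0, 0, 1:] * (p - pderiv p)) t) (at t)"
proof -
  consider "t > 0" | "t < 0" | "t = 0" by linarith
  then show ?thesis
  proof cases
    case 1
    have "((\<lambda>t. poly p (1 / t) * exp (- (1 / t))) has_field_derivative
        poly ([:0, 0, 1:] * (p - pderiv p)) (1 / t) * exp (- (1 / t))) (at t)"
    proof -
      have i: "((\<lambda>t. 1 / t) has_field_derivative - (1 / t)\<^sup>2) (at t)"
        using 1 DERIV_inverse[of t UNIV] by (simp add: inverse_eq_divide power_one_over numeral_2_eq_2)
      show ?thesis
        by (rule DERIV_cong[OF DERIV_mult[OF DERIV_chain2[OF poly_DERIV i]
              DERIV_chain2[OF DERIV_exp DERIV_minus[OF i]]]])
          (simp add: algebra_simps power2_eq_square)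
    qed
    then have "((\<lambda>t. poly p (1 / t) * exp (- (1 / t))) has_field_derivative
        flat_exp ([:0, 0, 1:] * (p - pderiv p)) t) (at t)"
      using 1 by (simp add: flat_exp_def)
    moreover have "eventually (\<lambda>t. t \<in> {0<..}) (nhds t)"
      using 1 by (intro eventually_nhds_in_open) auto
    then have "\<forall>\<^sub>F x in nhds t. flat_exp p x = poly p (1 / x) * exp (- (1 / x))"
      by eventually_elim (auto simp: flat_exp_def)
    from DERIV_cong_ev[OF refl this refl] calculation show ?thesis
      by (rule iffD2)
  next
    case 2
    have "((\<lambda>t. 0) has_field_derivative flat_exp ([:0, 0, 1:] * (p - pderiv p)) t) (at t)"
      using 2 by (simp add: flat_exp_def)
    moreover have "eventually (\<lambda>t. t \<in> {..<0}) (nhds t)"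
      using 2 by (intro eventually_nhds_in_open) auto
    then have "\<forall>\<^sub>F x in nhds t. flat_exp p x = 0"
      by eventually_elim (auto simp: flat_exp_def)
    from DERIV_cong_ev[OF refl this refl] calculation show ?thesis
      by (rule iffD2)
  next
    case 3
    then show ?thesis
      using flat_exp_quotient_tendsto[of p] by (simp add: DERIV_def flat_exp_def)
  qed
qed

text \<open>Contains the bump functions below and is closed under partial derivatives, so that all its
  elements are smooth.\<close>

inductive_set flat_alg :: "(real^2 \<Rightarrow> real) set" where
  base: "(\<lambda>x. flat_exp p (k * x $ i + d)) \<in> flat_alg"
| add: "f \<in> flat_alg \<Longrightarrow> g \<in> flat_alg \<Longrightarrow> (\<lambda>x. f x + g x) \<in> flat_alg"
| mult: "f \<in> flat_alg \<Longrightarrow> g \<in> flat_alg \<Longrightarrow> (\<lambda>x. f x * g x) \<in> flat_alg"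

lemma partial_DERIV:
  assumes "f differentiable (at x)"
  shows "((\<lambda>t. f (x + t *\<^sub>R axis i 1)) has_field_derivative partial i f x) (at 0)"
proof -
  have "f differentiable (at (x + 0 *\<^sub>R axis i 1))"
    using assms by simp
  moreover have "(\<lambda>t::real. x + t *\<^sub>R axis i 1) differentiable (at 0)"
    by (auto intro!: derivative_intros)
  ultimately have "(f \<circ> (\<lambda>t::real. x + t *\<^sub>R axis i 1)) differentiable (at 0)"
    by (metis differentiable_chain_at)
  then show ?thesis
    unfolding partial_def by (simp add: o_def DERIV_deriv_iff_real_differentiable)
qed

lemma partial_eqI:
  "((\<lambda>t. f (x + t *\<^sub>R axis i 1)) has_field_derivative D) (at 0) \<Longrightarrow> partial i f x = D"
  unfolding partial_def by (rule DERIV_imp_deriv)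

lemma flat_exp_smult: "flat_exp (smult c p) t = c * flat_exp p t"
  by (simp add: flat_exp_def)

text \<open>The factor from the chain rule, \<open>k\<close> or 0, is moved into the polynomial by
  \<open>smult\<close>. The derivative is then literally a generator of the algebra below, also in a
  direction on which the function does not depend.\<close>

lemma flat_exp_component_DERIV:
  "((\<lambda>t. flat_exp p (k * (x + t *\<^sub>R axis j 1 :: real^2) $ i + d)) has_field_derivative
     flat_exp (smult (if i = j then k else 0) ([:0, 0, 1:] * (p - pderiv p))) (k * x $ i + d)) (at 0)"
proof -
  have "((\<lambda>t::real. k * (x $ i + t * e) + d) has_field_derivative k * e) (at 0)" for e
    by (auto intro!: derivative_eq_intros)
  from this[of "axis j 1 $ i"]
  have a: "((\<lambda>t::real. k * (x + t *\<^sub>R axis j 1 :: real^2) $ i + d) has_field_derivative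
      (if i = j then k else 0)) (at 0)"
    by (simp add: axis_def split: if_splits)
  have "(flat_exp p has_field_derivative flat_exp ([:0, 0, 1:] * (p - pderiv p)) (k * x $ i + d))
      (at (k * (x + 0 *\<^sub>R axis j 1 :: real^2) $ i + d))"
    using flat_exp_has_derivative by simp
  from DERIV_chain2[OF this a] show ?thesis
    by (rule DERIV_cong) (simp only: flat_exp_smult mult.commute)
qed

text \<open>One induction carries both claims: \<open>partial\<close> is defined through
  \<open>deriv\<close>, which obeys the sum and product rules only once the two operands are known
  to be differentiable.\<close>

lemma flat_alg_differentiable_partial:
  "f \<in> flat_alg \<Longrightarrow> (\<forall>x. f differentiable (at x)) \<and> (\<forall>j. partial j f \<in> flat_alg)"
proof (induction rule: flat_alg.induct)
  case (base p k i d)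
  have "partial j (\<lambda>x. flat_exp p (k * x $ i + d)) =
      (\<lambda>x. flat_exp (smult (if i = j then k else 0) ([:0, 0, 1:] * (p - pderiv p))) (k * x $ i + d))" for j
    by (intro ext partial_eqI flat_exp_component_DERIV)
  moreover have "(flat_exp p \<circ> (\<lambda>x::real^2. k * x $ i + d)) differentiable (at x)" for x
  proof (rule differentiable_chain_at)
    have "((\<lambda>x::real^2. k * x $ i + d) has_derivative (\<lambda>h. k * h $ i)) (at x)"
      by (intro has_derivative_add_const has_derivative_mult_right
          bounded_linear_imp_has_derivative bounded_linear_vec_nth)
    then show "(\<lambda>x::real^2. k * x $ i + d) differentiable (at x)"
      by (auto simp: differentiable_def)
    show "flat_exp p differentiable (at (k * x $ i + d))"
      using flat_exp_has_derivative unfolding real_differentiable_def by (rule exI)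
  qed
  ultimately show ?case
    by (simp only: o_def flat_alg.base simp_thms)
next
  case (add f g)
  have "partial j (\<lambda>x. f x + g x) = (\<lambda>x. partial j f x + partial j g x)" for j
    using add.IH by (intro ext partial_eqI DERIV_add partial_DERIV) auto
  then show ?case
    using add.IH by (simp add: flat_alg.add)
next
  case (mult f g)
  have "partial j (\<lambda>x. f x * g x) = (\<lambda>x. partial j f x * g x + partial j g x * f x)" for j
  proof (intro ext partial_eqI)
    fix x
    show "((\<lambda>t. f (x + t *\<^sub>R axis j 1) * g (x + t *\<^sub>R axis j 1)) has_real_derivative
        partial j f x * g x + partial j g x * f x) (at 0)"
      using DERIV_mult[OF partial_DERIV[of f x j] partial_DERIV[of g x j]] mult.IH by simp
  qed
  then show ?case
    using mult.IH mult.hyps by (simp add: flat_alg.add flat_alg.mult)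
qed

lemma smooth_fun_flat_alg:
  assumes "f \<in> flat_alg"
  shows "smooth_fun f"
proof -
  have "foldr partial is f \<in> flat_alg" for "is"
    by (induction "is") (simp_all only: foldr.simps o_def id_def assms flat_alg_differentiable_partial)
  then show ?thesis
    unfolding smooth_fun_def differentiable_on_def
    by (intro allI ballI) (meson differentiable_at_withinI flat_alg_differentiable_partial)
qed

text \<open>Since \<open>exp (- 1 / (n t))\<close> increases to 1 for every \<open>t > 0\<close>, rescaling replaces the usual
  construction of smooth cut-off functions.\<close>

definition bump :: "real^2 \<Rightarrow> real^2 \<Rightarrow> nat \<Rightarrow> real^2 \<Rightarrow> real" where
  "bump a b n x =
     flat_exp 1 (real n * x $ 1 + - real n * a $ 1) * flat_exp 1 (- real n * x $ 1 + real n * b $ 1) *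
    (flat_exp 1 (real n * x $ 2 + - real n * a $ 2) * flat_exp 1 (- real n * x $ 2 + real n * b $ 2))"

lemma flat_exp_one_bounds: "0 \<le> flat_exp 1 t" "flat_exp 1 t \<le> 1"
  by (auto simp: flat_exp_def)

lemma bump_bounds: "0 \<le> bump a b n x" "bump a b n x \<le> 1"
  unfolding bump_def by (intro mult_nonneg_nonneg mult_le_one flat_exp_one_bounds)+

lemma bump_eq_0:
  assumes "x \<notin> box a b"
  shows "bump a b n x = 0"
proof -
  have "\<not> a $ 1 < x $ 1 \<or> \<not> x $ 1 < b $ 1 \<or> \<not> a $ 2 < x $ 2 \<or> \<not> x $ 2 < b $ 2"
    using assms by (simp add: mem_box_cart forall_2)
  moreover have "flat_exp 1 (real n * s + - real n * t) = 0" if "\<not> t < s" for s t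
    using that by (simp add: flat_exp_def mult_left_mono not_less)
  moreover have "flat_exp 1 (- real n * s + real n * t) = 0" if "\<not> s < t" for s t
    using that by (simp add: flat_exp_def mult_left_mono not_less)
  ultimately show ?thesis
    unfolding bump_def by (elim disjE) simp_all
qed

lemma flat_exp_one_tendsto: "0 < t \<Longrightarrow> (\<lambda>n. flat_exp 1 (real n * t)) \<longlonglongrightarrow> 1"
proof -
  assume t: "0 < t"
  have "(\<lambda>n. exp (- (1 / t * inverse (real n)))) \<longlonglongrightarrow> exp (- (1 / t * 0))"
    by (intro tendsto_intros lim_inverse_n)
  then have "(\<lambda>n. exp (- (1 / t * inverse (real n)))) \<longlonglongrightarrow> 1"
    by simp
  moreover have "\<forall>\<^sub>F n in sequentially. exp (- (1 / t * inverse (real n))) = flat_exp 1 (real n * t)"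
    using eventually_gt_at_top[of 0] by eventually_elim (use t in \<open>auto simp: flat_exp_def field_simps\<close>)
  ultimately show ?thesis
    by (rule Lim_transform_eventually)
qed

lemma bump_tendsto: "(\<lambda>n. bump a b n x) \<longlonglongrightarrow> indicator (box a b) x"
proof (cases "x \<in> box a b")
  case True
  then have *: "\<And>i. 0 < x $ i - a $ i" "\<And>i. 0 < b $ i - x $ i"
    by (auto simp: mem_box_cart)
  have "(\<lambda>n. flat_exp 1 (real n * (x $ 1 - a $ 1)) * flat_exp 1 (real n * (b $ 1 - x $ 1)) *
    (flat_exp 1 (real n * (x $ 2 - a $ 2)) * flat_exp 1 (real n * (b $ 2 - x $ 2)))) \<longlonglongrightarrow> 1 * 1 * (1 * 1)"
    by (intro tendsto_mult flat_exp_one_tendsto *)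
  then show ?thesis
    using True by (simp add: bump_def right_diff_distrib add.commute)
qed (simp add: bump_eq_0)

lemma test_fun_bump:
  assumes "cbox a b \<subseteq> opq"
  shows "test_fun (bump a b n)"
proof -
  have "bump a b n \<in> flat_alg"
    \<comment> \<open>The arguments in \<open>bump\<close> are written as
      \<open>k * x $ i + d\<close> so that each factor is an instance of
      \<open>flat_alg.base\<close>.\<close>
    unfolding bump_def[abs_def] by (rule flat_alg.mult; rule flat_alg.mult; rule flat_alg.base)
  then have "smooth_fun (bump a b n)"
    by (simp add: smooth_fun_flat_alg)
  moreover have "bump a b n x = 0" if "x \<notin> cbox a b" for x
    using that box_subset_cbox[of a b] by (intro bump_eq_0) auto
  ultimately show ?thesis
    unfolding test_fun_def using assms compact_cbox by blast
qed

subsection \<open>Signed Radon measures and test functions\<close>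

abbreviation opq_borel :: "(real^2) measure" where
  "opq_borel \<equiv> restrict_space borel opq"

lemma open_opq: "open opq"
  unfolding opq_def by (intro open_Collect_conj open_Collect_less continuous_intros)

lemma opq_borel_sets [measurable]: "opq \<in> sets borel"
  using open_opq by simp

lemma sets_opq_borel_iff: "A \<in> sets opq_borel \<longleftrightarrow> A \<subseteq> opq \<and> A \<in> sets borel"
  by (rule sets_restrict_space_iff) simp

lemma compact_sets_opq_borel: "compact K \<Longrightarrow> K \<subseteq> opq \<Longrightarrow> K \<in> sets opq_borel"
  by (simp add: sets_opq_borel_iff borel_compact)

lemma rel_compact_sets: "A \<in> rel_compact \<Longrightarrow> A \<in> sets opq_borel"
  unfolding rel_compact_def sets_opq_borel_iff by blast

text \<open>Measures cannot be subtracted, so two decompositions of one signed measure are compared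
  by adding crosswise. This is the sum of measures that such identities need.\<close>

definition measure_add :: "'a measure \<Rightarrow> 'a measure \<Rightarrow> 'a measure" where
  "measure_add M N = measure_of (space M) (sets M) (\<lambda>A. emeasure M A + emeasure N A)"

lemma space_measure_add [simp]: "space (measure_add M N) = space M"
  and sets_measure_add [simp, measurable_cong]: "sets (measure_add M N) = sets M"
  unfolding measure_add_def by (simp_all add: space_measure_of sets.space_closed sets.sets_measure_of_eq)

lemma emeasure_measure_add:
  assumes "sets N = sets M" "A \<in> sets M"
  shows "emeasure (measure_add M N) A = emeasure M A + emeasure N A"
  unfolding measure_add_def
proof (rule emeasure_measure_of_sigma)
  show "sigma_algebra (space M) (sets M)" ..
  show "positive (sets M) (\<lambda>A. emeasure M A + emeasure N A)"
    by (simp add: positive_def)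
  show "countably_additive (sets M) (\<lambda>A. emeasure M A + emeasure N A)"
  proof (rule countably_additiveI)
    fix B :: "nat \<Rightarrow> _"
    assume B: "range B \<subseteq> sets M" "disjoint_family B"
    have "(\<Sum>i. emeasure M (B i) + emeasure N (B i)) = (\<Sum>i. emeasure M (B i)) + (\<Sum>i. emeasure N (B i))"
      by (intro suminf_add[symmetric] summableI)
    then show "(\<Sum>i. emeasure M (B i) + emeasure N (B i)) = emeasure M (\<Union>i. B i) + emeasure N (\<Union>i. B i)"
      using B assms(1) by (simp add: suminf_emeasure)
  qed
qed fact

lemma nn_integral_measure_add:
  assumes [measurable_cong]: "sets N = sets M" and "f \<in> borel_measurable M"
  shows "(\<integral>\<^sup>+x. f x \<partial>measure_add M N) = (\<integral>\<^sup>+x. f x \<partial>M) + (\<integral>\<^sup>+x. f x \<partial>N)"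
  using assms(2)
proof induction
  case (cong f g)
  have sp: "space N = space M"
    using assms(1) by (rule sets_eq_imp_space_eq)
  have "integral\<^sup>N K f = integral\<^sup>N K g" if "space K = space M" for K
    using that cong(3) by (intro nn_integral_cong) simp
  from this[of "measure_add M N"] this[of M] this[of N] show ?case
    using cong(4) sp by simp
next
  case (set A)
  then show ?case
    using assms(1) by (simp add: emeasure_measure_add)
next
  case (mult u c)
  then show ?case
    using assms(1) by (simp add: nn_integral_cmult distrib_left)
next
  case (add u v)
  then show ?case
    using assms(1) by (simp add: nn_integral_add ac_simps)
next
  case (seq U)
  have [measurable]: "\<And>i. U i \<in> borel_measurable N"
    using seq(1) measurable_cong_sets[OF assms(1) refl] by blast
  \<comment> \<open>Suprema of sums split into sums of suprema only because both sequences of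
    integrals increase.\<close>
  have i: "incseq (\<lambda>i. integral\<^sup>N K (U i))" for K
    using seq(3) by (auto simp: incseq_def le_fun_def intro!: nn_integral_mono)
  show ?case
    unfolding SUP_apply
    using seq i by (simp add: nn_integral_monotone_convergence_SUP ennreal_SUP_add)
qed

lemma integrable_measure_add:
  fixes f :: "'a \<Rightarrow> real"
  assumes "sets N = sets M"
  shows "integrable (measure_add M N) f \<longleftrightarrow> integrable M f \<and> integrable N f"
proof -
  have m: "borel_measurable (measure_add M N) = borel_measurable M"
    "borel_measurable N = (borel_measurable M :: ('a \<Rightarrow> real) set)"
    using assms by (intro measurable_cong_sets; simp)+
  show ?thesis
    unfolding integrable_iff_bounded m
    by (auto simp: nn_integral_measure_add[OF assms])
qed

lemma integral_measure_add:
  fixes f :: "'a \<Rightarrow> real"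
  assumes "sets N = sets M" "integrable M f" "integrable N f"
  shows "(LINT x|measure_add M N. f x) = (LINT x|M. f x) + (LINT x|N. f x)"
proof -
  have "integrable (measure_add M N) f"
    using assms by (simp add: integrable_measure_add)
  moreover have [measurable]: "f \<in> borel_measurable M"
    using assms by simp
  \<comment> \<open>\<open>enn2real\<close> is additive on finite values only, so the positive and
    negative parts must be finite under both measures.\<close>
  have "(\<integral>\<^sup>+x. ennreal (f x) \<partial>M) < top" "(\<integral>\<^sup>+x. ennreal (- f x) \<partial>M) < top"
    "(\<integral>\<^sup>+x. ennreal (f x) \<partial>N) < top" "(\<integral>\<^sup>+x. ennreal (- f x) \<partial>N) < top"
    using assms(2,3) by (simp_all add: real_integrable_def less_top)
  ultimately show ?thesis
    using assms by (simp add: real_lebesgue_integral_def nn_integral_measure_add enn2real_plus)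
qed

section \<open>Radon measures on the open quadrant and their determination by boxes\<close>

lemma radon_sets: "radon M \<Longrightarrow> sets M = sets opq_borel"
  by (simp add: radon_def)

lemma radon_measurable: "radon M \<Longrightarrow> borel_measurable M = borel_measurable opq_borel"
  by (intro measurable_cong_sets refl radon_sets)

lemma radon_space: "radon M \<Longrightarrow> space M = opq"
  using sets_eq_imp_space_eq[OF radon_sets] by (simp add: space_restrict_space)

lemma radon_measure_add: "radon M \<Longrightarrow> radon N \<Longrightarrow> radon (measure_add M N)"
  unfolding radon_def by (auto simp: emeasure_measure_add compact_sets_opq_borel)

lemma radon_null_measure: "radon M \<Longrightarrow> radon (null_measure M)"
  unfolding radon_def by simp

lemma radon_rel_compact_finite:
  assumes "radon M" "A \<in> rel_compact"
  shows "emeasure M A < top"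
proof -
  obtain K where "compact K" "A \<subseteq> K" "K \<subseteq> opq"
    using assms(2) by (auto simp: rel_compact_def)
  then have "emeasure M A \<le> emeasure M K" "emeasure M K < \<infinity>"
    using assms(1) by (auto simp: radon_def compact_sets_opq_borel intro!: emeasure_mono)
  then show ?thesis
    by (simp add: order_le_less_trans)
qed

lemma radon_rel_compact_measure:
  "radon M \<Longrightarrow> A \<in> rel_compact \<Longrightarrow> emeasure M A = ennreal (measure M A)"
  using radon_rel_compact_finite[of M A] by (simp add: emeasure_eq_ennreal_measure)

lemma box_rel_compact: "cbox a b \<subseteq> opq \<Longrightarrow> box a b \<in> rel_compact"
  unfolding rel_compact_def
  by (intro CollectI conjI exI[of _ "cbox a b"]) (auto simp: box_subset_cbox)

text \<open>The closed boxes are kept inside \<open>U\<close> so that the open ones are relatively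
  compact. With \<open>U\<close> an arbitrary open subset of the quadrant this shows that such boxes
  generate the Borel sets; with \<open>U = opq\<close> it gives a countable cover by sets of finite
  measure.\<close>

lemma open_eq_countable_Union_boxes:
  fixes U :: "'a::euclidean_space set"
  assumes "open U"
  obtains D where "countable D" "D \<subseteq> {box a b |a b. cbox a b \<subseteq> U}" "\<Union>D = U"
proof -
  obtain D where D: "D \<subseteq> {box a b |a b. cbox a b \<subseteq> U}" "countable D"
      "\<Union>D = \<Union>{box a b |a b. cbox a b \<subseteq> U}"
    by (rule Lindelof[of "{box a b |a b. cbox a b \<subseteq> U}"]) auto
  moreover have "\<Union>{box a b |a b. cbox a b \<subseteq> U} = U"
  proof (intro equalityI subsetI)
    fix x assume "x \<in> U"
    then obtain a b where "cbox a b \<subseteq> U" "x \<in> box a b"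
      using open_contains_cbox[OF assms] by metis
    then show "x \<in> \<Union>{box a b |a b. cbox a b \<subseteq> U}" by blast
  qed (use box_subset_cbox in blast)
  ultimately show thesis using that by simp
qed

lemma sets_opq_borel_generated:
  "sets opq_borel = sigma_sets opq {box a b |a b. cbox a b \<subseteq> opq}" (is "_ = sigma_sets _ ?E")
proof
  have "sets opq_borel = (\<inter>) opq ` sigma_sets UNIV {S. open S}"
    by (simp add: sets_restrict_space sets_borel)
  also have "\<dots> = sigma_sets opq ((\<inter>) opq ` {S. open S})"
    by (rule sigma_sets_Int) (use open_opq in auto)
  also have "\<dots> \<subseteq> sigma_sets opq ?E"
  proof (rule sigma_sets_mono, rule subsetI)
    fix U assume "U \<in> (\<inter>) opq ` {S. open S}"
    then have U: "open U" "U \<subseteq> opq"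
      using open_opq by auto
    from open_eq_countable_Union_boxes[OF U(1)] obtain D
      where D: "countable D" "D \<subseteq> {box a b |a b. cbox a b \<subseteq> U}" "\<Union>D = U" .
    have "X \<in> sigma_sets opq ?E" if "X \<in> D" for X
      using that D(2) U(2) by (intro sigma_sets.Basic) blast
    then have "\<Union>D \<in> sigma_sets opq ?E"
      by (rule sigma_sets_UNION[OF D(1)])
    then show "U \<in> sigma_sets opq ?E"
      by (simp only: D(3))
  qed
  finally show "sets opq_borel \<subseteq> sigma_sets opq ?E" .
next
  have "?E \<subseteq> sets opq_borel"
    using box_rel_compact rel_compact_sets by blast
  then show "sigma_sets opq ?E \<subseteq> sets opq_borel"
    using sets.sigma_sets_subset[of ?E opq_borel] by (simp add: space_restrict_space)
qed

text \<open>The uniqueness theorem for measures agreeing on an intersection-stable generator. Total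
  masses may be infinite, so the countable cover \<open>D\<close> by boxes of finite measure
  supplies the required sigma-finiteness.\<close>

lemma radon_eqI:
  assumes "radon M" "radon N"
    and eq: "\<And>a b. cbox a b \<subseteq> opq \<Longrightarrow> emeasure M (box a b) = emeasure N (box a b)"
  shows "M = N"
proof -
  from open_eq_countable_Union_boxes[OF open_opq] obtain D
    where D: "countable D" "D \<subseteq> {box a b |a b. cbox a b \<subseteq> opq}" "\<Union>D = opq" .
  show ?thesis
  proof (rule measure_eqI_generator_eq_countable)
    show "Int_stable {box a b |a b. cbox a b \<subseteq> opq}"
    proof (rule Int_stableI)
      fix X Y
      assume "X \<in> {box a b |a b. cbox a b \<subseteq> opq}" "Y \<in> {box a b |a b. cbox a b \<subseteq> opq}"
      then obtain a b a' b' where X: "X = box a b" "cbox a b \<subseteq> opq" and Y: "Y = box a' b'"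
        by blast
      \<comment> \<open>Open and closed boxes intersect in boxes with the same corners, so the
        closed box belonging to \<open>X \<inter> Y\<close> lies in \<open>cbox a b\<close>.\<close>
      have "cbox a b \<inter> cbox a' b' \<subseteq> opq"
        using X(2) by blast
      then show "X \<inter> Y \<in> {box a b |a b. cbox a b \<subseteq> opq}"
        unfolding X(1) Y box_Int_box Int_interval by blast
    qed
    show "{box a b |a b. cbox a b \<subseteq> opq} \<subseteq> Pow opq"
      using box_subset_cbox by blast
    show "emeasure M X \<noteq> \<infinity>" if "X \<in> D" for X
    proof -
      have "X \<in> rel_compact"
        using that D(2) box_rel_compact by blast
      then show ?thesis
        using radon_rel_compact_finite[OF assms(1)] by fastforce
    qed
  qed (use assms D in \<open>auto simp: radon_sets sets_opq_borel_generated\<close>)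
qed

lemma sr_rep_radon: "sr_rep \<nu> P N \<Longrightarrow> radon P" "sr_rep \<nu> P N \<Longrightarrow> radon N"
  by (simp_all add: sr_rep_def)

lemma sr_rep_value: "sr_rep \<nu> P N \<Longrightarrow> A \<in> rel_compact \<Longrightarrow> \<nu> A = measure P A - measure N A"
  by (simp add: sr_rep_def)

lemma sr_rep_outside: "sr_rep \<nu> P N \<Longrightarrow> A \<notin> rel_compact \<Longrightarrow> \<nu> A = 0"
  by (simp add: sr_rep_def)

text \<open>On boxes all four measures are finite, and the equality of differences can be rearranged
  into one of sums. The sums are positive Radon measures, so equality spreads from boxes to all
  Borel sets, including those where the difference itself has no meaning.\<close>

lemma sr_rep_measure_add_eq:
  assumes "sr_rep \<nu> P N" "sr_rep \<nu> P' N'"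
  shows "measure_add P N' = measure_add P' N"
proof (rule radon_eqI)
  have r: "radon P" "radon N" "radon P'" "radon N'"
    using assms by (simp_all add: sr_rep_radon)
  then show "radon (measure_add P N')" "radon (measure_add P' N)"
    by (simp_all add: radon_measure_add)
  fix a b :: "real^2"
  assume "cbox a b \<subseteq> opq"
  then have A: "box a b \<in> rel_compact"
    by (rule box_rel_compact)
  have "measure P (box a b) - measure N (box a b) = measure P' (box a b) - measure N' (box a b)"
    using sr_rep_value[OF assms(1) A] sr_rep_value[OF assms(2) A] by simp
  then have "measure P (box a b) + measure N' (box a b) = measure P' (box a b) + measure N (box a b)"
    by simp
  then show "emeasure (measure_add P N') (box a b) = emeasure (measure_add P' N) (box a b)"
    using A r by (simp add: emeasure_measure_add rel_compact_sets radon_sets radon_rel_compact_measure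
        flip: ennreal_plus)
qed

text \<open>Integrating \<open>F\<close> against the crosswise sum identity shows that the value
  does not depend on the decomposition, which makes the \<open>THE\<close> in
  \<open>sr_integral\<close> meaningful.\<close>

lemma has_sr_integral_unique:
  assumes "has_sr_integral \<nu> F I" "has_sr_integral \<nu> F J"
  shows "I = J"
proof -
  obtain P N P' N' where r: "sr_rep \<nu> P N" "sr_rep \<nu> P' N'"
    and i: "integrable P F" "integrable N F" "integrable P' F" "integrable N' F"
    and I: "I = (LINT x|P. F x) - (LINT x|N. F x)" and J: "J = (LINT x|P'. F x) - (LINT x|N'. F x)"
    using assms by (auto simp: has_sr_integral_def)
  have "sets N' = sets P" "sets N = sets P'"
    using r by (simp_all add: sr_rep_radon radon_sets)
  then have "(LINT x|P. F x) + (LINT x|N'. F x) = (LINT x|P'. F x) + (LINT x|N. F x)"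
    using i sr_rep_measure_add_eq[OF r] by (simp flip: integral_measure_add)
  then show ?thesis
    unfolding I J by simp
qed

lemma sr_integral_eqI: "has_sr_integral \<nu> F I \<Longrightarrow> sr_integral \<nu> F = I"
  unfolding sr_integral_def by (rule the_equality) (auto intro: has_sr_integral_unique)

text \<open>The class of admissible densities. It has to contain the continuous coefficients,
  possibly unbounded on the quadrant, as well as the discontinuous gradient of the reward, to be
  closed under products, and to keep densities of Radon measures Radon.\<close>

definition loc_bounded :: "(real^2 \<Rightarrow> real) \<Rightarrow> bool" where
  "loc_bounded h \<longleftrightarrow> h \<in> borel_measurable opq_borel \<and> (\<forall>K. compact K \<and> K \<subseteq> opq \<longrightarrow> bounded (h ` K))"

lemma loc_bounded_continuous:
  assumes "continuous_on opq h"
  shows "loc_bounded h"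
  unfolding loc_bounded_def
proof (intro conjI allI impI)
  show "h \<in> borel_measurable opq_borel"
    using assms by (rule borel_measurable_continuous_on_restrict)
  fix K assume "compact K \<and> K \<subseteq> opq"
  then show "bounded (h ` K)"
    using assms by (intro compact_imp_bounded compact_continuous_image) (auto intro: continuous_on_subset)
qed

lemma loc_bounded_bounded:
  "h \<in> borel_measurable opq_borel \<Longrightarrow> bounded (h ` opq) \<Longrightarrow> loc_bounded h"
  unfolding loc_bounded_def by (auto intro: bounded_subset)

lemma loc_bounded_const [simp]: "loc_bounded (\<lambda>x. k)"
  by (rule loc_bounded_continuous) simp

lemma loc_bounded_add: "loc_bounded f \<Longrightarrow> loc_bounded g \<Longrightarrow> loc_bounded (\<lambda>x. f x + g x)"
  unfolding loc_bounded_def by (auto intro: bounded_plus_comp)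

lemma loc_bounded_diff: "loc_bounded f \<Longrightarrow> loc_bounded g \<Longrightarrow> loc_bounded (\<lambda>x. f x - g x)"
  unfolding loc_bounded_def by (auto intro: bounded_minus_comp)

lemma loc_bounded_mult:
  assumes "loc_bounded f" "loc_bounded g"
  shows "loc_bounded (\<lambda>x. f x * g x)"
  unfolding loc_bounded_def
proof (intro conjI allI impI)
  show "(\<lambda>x. f x * g x) \<in> borel_measurable opq_borel"
    using assms by (auto simp: loc_bounded_def intro: borel_measurable_times)
  fix K assume K: "compact K \<and> K \<subseteq> opq"
  have "bounded (f ` K)" "bounded (g ` K)"
    using assms K unfolding loc_bounded_def by simp_all
  then obtain B C where BC: "\<And>x. x \<in> K \<Longrightarrow> \<bar>f x\<bar> \<le> B" "\<And>x. x \<in> K \<Longrightarrow> \<bar>g x\<bar> \<le> C"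
    unfolding bounded_iff by auto
  have "\<bar>f x * g x\<bar> \<le> B * C" if "x \<in> K" for x
  proof -
    have "0 \<le> B"
      using BC(1)[OF that] by linarith
    then show ?thesis
      unfolding abs_mult using BC that by (intro mult_mono) auto
  qed
  then show "bounded ((\<lambda>x. f x * g x) ` K)"
    by (auto simp: bounded_iff)
qed

lemma radon_integrable:
  assumes "radon M" "loc_bounded h" "compact K" "K \<subseteq> opq" "\<And>x. x \<in> opq - K \<Longrightarrow> h x = 0"
  shows "integrable M h"
proof -
  have "bounded (h ` K)"
    using assms(2-4) unfolding loc_bounded_def by simp
  then obtain B where B: "\<And>x. x \<in> K \<Longrightarrow> norm (h x) \<le> B"
    unfolding bounded_iff by auto
  show ?thesis
  proof (rule integrableI_bounded_set[where A = K and B = B])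
    show "K \<in> sets M"
      using assms by (simp add: radon_sets compact_sets_opq_borel)
    show "h \<in> borel_measurable M"
      using assms by (simp add: radon_measurable loc_bounded_def)
    show "emeasure M K < \<infinity>"
      using assms by (simp add: radon_def)
    show "AE x in M. x \<in> K \<longrightarrow> norm (h x) \<le> B"
      using B by simp
    show "AE x in M. x \<notin> K \<longrightarrow> h x = 0"
      using assms(1,5) by (intro AE_I2) (simp add: radon_space)
  qed
qed

lemma smooth_fun_continuous:
  assumes "smooth_fun f"
  shows "continuous_on S f"
proof -
  have "foldr partial [] f differentiable_on UNIV"
    using assms unfolding smooth_fun_def by (rule spec)
  then have "continuous_on UNIV f"
    by (simp add: differentiable_imp_continuous_on)
  then show ?thesis
    by (rule continuous_on_subset) simp
qed

lemma test_fun_continuous: "test_fun \<phi> \<Longrightarrow> continuous_on S \<phi>"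
  by (simp add: test_fun_def smooth_fun_continuous)

lemma loc_bounded_test_fun: "test_fun \<phi> \<Longrightarrow> loc_bounded \<phi>"
  by (intro loc_bounded_continuous test_fun_continuous)

lemma integrable_mult_test_fun:
  assumes "radon M" "loc_bounded h" "test_fun \<phi>"
  shows "integrable M (\<lambda>x. h x * \<phi> x)"
proof -
  obtain K where "compact K" "K \<subseteq> opq" "\<And>x. x \<notin> K \<Longrightarrow> \<phi> x = 0"
    using assms(3) unfolding test_fun_def by blast
  then show ?thesis
    using assms(1) loc_bounded_mult[OF assms(2) loc_bounded_test_fun[OF assms(3)]]
    by (intro radon_integrable[of M _ K]) auto
qed

lemma integrable_test_fun: "radon M \<Longrightarrow> test_fun \<phi> \<Longrightarrow> integrable M \<phi>"
  using integrable_mult_test_fun[of M "\<lambda>x. 1" \<phi>] by simp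

text \<open>The measure of a box is the limit of the integrals of its bumps, so integrals of test
  functions determine the measure on boxes and hence everywhere.\<close>

lemma radon_eqI_test_fun:
  assumes "radon M" "radon N" "\<And>\<phi>. test_fun \<phi> \<Longrightarrow> (LINT x|M. \<phi> x) = (LINT x|N. \<phi> x)"
  shows "M = N"
proof (rule radon_eqI[OF assms(1,2)])
  fix a b :: "real^2"
  assume ab: "cbox a b \<subseteq> opq"
  have lim: "(\<lambda>n. LINT x|K. bump a b n x) \<longlonglongrightarrow> measure K (box a b)" if K: "radon K" for K
  proof -
    have s: "box a b \<in> sets K"
      using K ab by (simp add: radon_sets rel_compact_sets box_rel_compact)
    have i: "integrable K (indicator (box a b) :: _ \<Rightarrow> real)"
      using s radon_rel_compact_finite[OF K box_rel_compact[OF ab]] by (simp add: integrable_indicator_iff)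
    \<comment> \<open>The indicator of the box is both the limit and the dominating function: bumps
      lie between 0 and 1 and vanish off the box, whose measure is finite because
      \<open>cbox a b\<close> is compact in the quadrant.\<close>
    have "(\<lambda>n. LINT x|K. bump a b n x) \<longlonglongrightarrow> (LINT x|K. indicator (box a b) x)"
    proof (rule integral_dominated_convergence[where w = "indicator (box a b)"])
      show "bump a b n \<in> borel_measurable K" for n
        using integrable_test_fun[OF K test_fun_bump[OF ab]] by simp
      show "AE x in K. norm (bump a b n x) \<le> indicator (box a b) x" for n
        using bump_bounds[of a b n] bump_eq_0[of _ a b n] by (intro AE_I2) (simp split: split_indicator)
    qed (use i s in \<open>auto intro: bump_tendsto\<close>)
    then show ?thesis
      using s by simp
  qed
  have "measure M (box a b) = measure N (box a b)"
    using lim[OF assms(1)] lim[OF assms(2)] assms(3)[OF test_fun_bump[OF ab]]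
    by (simp add: LIMSEQ_unique)
  then show "emeasure M (box a b) = emeasure N (box a b)"
    using assms(1,2) box_rel_compact[OF ab] by (simp add: radon_rel_compact_measure)
qed

lemma sr_integral_rep:
  "sr_rep \<nu> P N \<Longrightarrow> integrable P F \<Longrightarrow> integrable N F \<Longrightarrow>
    sr_integral \<nu> F = (LINT x|P. F x) - (LINT x|N. F x)"
  by (rule sr_integral_eqI) (auto simp: has_sr_integral_def)

text \<open>The uniqueness result for positive measures is applied to the crosswise sums. Equality
  of set functions then also covers sets that are not relatively compact, since both sides are 0
  there by convention.\<close>

lemma signed_radon_eqI:
  assumes "signed_radon \<nu>" "signed_radon \<nu>'"
    and "\<And>\<phi>. test_fun \<phi> \<Longrightarrow> sr_integral \<nu> \<phi> = sr_integral \<nu>' \<phi>"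
  shows "\<nu> = \<nu>'"
proof -
  obtain P N P' N' where rep: "sr_rep \<nu> P N" "sr_rep \<nu>' P' N'"
    using assms by (auto simp: signed_radon_def)
  then have r: "radon P" "radon N" "radon P'" "radon N'"
    by (simp_all add: sr_rep_radon)
  have s: "sets N' = sets P" "sets N = sets P'"
    using r by (simp_all add: radon_sets)
  have eq: "measure_add P N' = measure_add P' N"
  proof (rule radon_eqI_test_fun)
    fix \<phi> assume \<phi>: "test_fun \<phi>"
    have i: "integrable K \<phi>" if "radon K" for K
      using that \<phi> by (rule integrable_test_fun)
    have "(LINT x|P. \<phi> x) - (LINT x|N. \<phi> x) = (LINT x|P'. \<phi> x) - (LINT x|N'. \<phi> x)"
      using assms(3)[OF \<phi>] rep i r by (simp add: sr_integral_rep)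
    then show "(LINT x|measure_add P N'. \<phi> x) = (LINT x|measure_add P' N. \<phi> x)"
      using i r s by (simp add: integral_measure_add)
  qed (use r in \<open>simp_all add: radon_measure_add\<close>)
  show ?thesis
  proof
    fix A
    show "\<nu> A = \<nu>' A"
    proof (cases "A \<in> rel_compact")
      case True
      then have "A \<in> sets P" "A \<in> sets P'"
        using r by (simp_all add: radon_sets rel_compact_sets)
      then have "emeasure P A + emeasure N' A = emeasure P' A + emeasure N A"
        using s eq by (simp flip: emeasure_measure_add)
      then have "measure P A + measure N' A = measure P' A + measure N A"
        using True r by (simp add: radon_rel_compact_measure flip: ennreal_plus)
      then show ?thesis
        using rep[THEN sr_rep_value, OF True] by simp
    qed (use rep[THEN sr_rep_outside] in simp)
  qed
qed

subsection \<open>Signed measures with a density\<close>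

lemma loc_bounded_measurable: "radon M \<Longrightarrow> loc_bounded h \<Longrightarrow> h \<in> borel_measurable M"
  by (simp add: loc_bounded_def radon_measurable)

text \<open>\<open>ennreal\<close> sends negative reals to 0, so the density here is the positive
  part of \<open>h\<close>; applied to \<open>- h\<close> the lemma treats the negative
  part.\<close>

lemma radon_density:
  assumes M: "radon M" and h: "loc_bounded h"
  shows "radon (density M (\<lambda>x. ennreal (h x)))"
  unfolding radon_def
proof (intro conjI allI impI)
  show "sets (density M (\<lambda>x. ennreal (h x))) = sets opq_borel"
    using M by (simp add: radon_sets)
  fix K assume K: "compact K \<and> K \<subseteq> opq"
  then have KM: "K \<in> sets M"
    using M by (simp add: radon_sets compact_sets_opq_borel)
  have hM: "(\<lambda>x. ennreal (h x)) \<in> borel_measurable M"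
    using loc_bounded_measurable[OF M h] by simp
  have "bounded (h ` K)"
    using h K unfolding loc_bounded_def by simp
  then obtain B where B: "\<And>x. x \<in> K \<Longrightarrow> norm (h x) \<le> B"
    unfolding bounded_iff by auto
  have "emeasure (density M (\<lambda>x. ennreal (h x))) K = (\<integral>\<^sup>+x. ennreal (h x) * indicator K x \<partial>M)"
    using KM hM by (simp add: emeasure_density)
  also have "\<dots> \<le> (\<integral>\<^sup>+x. ennreal B * indicator K x \<partial>M)"
  proof (rule nn_integral_mono)
    fix x
    show "ennreal (h x) * indicator K x \<le> ennreal B * indicator K x"
    proof (cases "x \<in> K")
      case True
      then have "h x \<le> B"
        using B[OF True] by simp
      then show ?thesis
        by (simp add: ennreal_leI mult_right_mono)
    qed simp
  qed
  also have "\<dots> = ennreal B * emeasure M K"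
    using KM by (simp add: nn_integral_cmult_indicator)
  also have "\<dots> < \<infinity>"
    using M K by (simp add: radon_def ennreal_mult_less_top)
  finally show "emeasure (density M (\<lambda>x. ennreal (h x))) K < \<infinity>" .
qed

lemma sr_rep_sr_of: "radon M \<Longrightarrow> sr_rep (sr_of M) M (null_measure M)"
  unfolding sr_rep_def sr_of_def by (simp add: radon_null_measure Sigma_Algebra.measure_def)

lemma sr_integral_sr_of:
  assumes "radon M" "integrable M F"
  shows "sr_integral (sr_of M) F = (LINT x|M. F x)"
proof -
  have "integrable (null_measure M) F"
    using assms measurable_cong_sets[of "null_measure M" M borel "borel :: real measure"]
    by (simp add: integrable_iff_bounded)
  then show ?thesis
    using assms by (simp add: sr_integral_rep[OF sr_rep_sr_of])
qed

lemma loc_bounded_indicator: "A \<in> rel_compact \<Longrightarrow> loc_bounded (\<lambda>x. indicator A x)"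
  by (rule loc_bounded_bounded)
    (auto simp: rel_compact_sets bounded_iff intro!: borel_measurable_indicator exI[of _ 1]
      split: split_indicator)

lemma integrable_indicator_mult:
  assumes "radon M" "loc_bounded h" "A \<in> rel_compact"
  shows "integrable M (\<lambda>x. indicator A x * h x)"
proof -
  obtain K where K: "compact K" "A \<subseteq> K" "K \<subseteq> opq"
    using assms(3) by (auto simp: rel_compact_def)
  show ?thesis
  proof (rule radon_integrable[OF assms(1) _ K(1,3)])
    show "loc_bounded (\<lambda>x. indicator A x * h x)"
      using assms by (intro loc_bounded_mult loc_bounded_indicator)
  qed (use K(2) in \<open>auto split: split_indicator\<close>)
qed

lemma sr_scale_sr_of:
  "radon M \<Longrightarrow> loc_bounded h \<Longrightarrow> A \<in> rel_compact \<Longrightarrow>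
    sr_scale h (sr_of M) A = (LINT x|M. indicator A x * h x)"
  unfolding sr_scale_def by (simp add: sr_integral_sr_of integrable_indicator_mult)

lemma loc_bounded_uminus: "loc_bounded h \<Longrightarrow> loc_bounded (\<lambda>x. - h x)"
  using loc_bounded_mult[of "\<lambda>x. -1" h] by simp

lemma measure_density_loc_bounded:
  assumes M: "radon M" and h: "loc_bounded h" and A: "A \<in> rel_compact"
  shows "measure (density M (\<lambda>x. ennreal (h x))) A = enn2real (\<integral>\<^sup>+x. ennreal (indicator A x * h x) \<partial>M)"
proof -
  have "(\<lambda>x. ennreal (h x)) \<in> borel_measurable M"
    using loc_bounded_measurable[OF M h] by simp
  then have "emeasure (density M (\<lambda>x. ennreal (h x))) A = (\<integral>\<^sup>+x. ennreal (h x) * indicator A x \<partial>M)"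
    using rel_compact_sets[OF A] by (simp add: emeasure_density radon_sets[OF M])
  also have "\<dots> = (\<integral>\<^sup>+x. ennreal (indicator A x * h x) \<partial>M)"
    by (rule nn_integral_cong) (simp split: split_indicator)
  finally show ?thesis
    by (simp add: Sigma_Algebra.measure_def)
qed

text \<open>The decomposition by the positive and negative parts of \<open>h\<close>. It matches the
  description of the real integral as a difference of two nonnegative integrals, both finite on
  relatively compact sets.\<close>

lemma sr_rep_scale:
  assumes M: "radon M" and h: "loc_bounded h"
  shows "sr_rep (sr_scale h (sr_of M)) (density M (\<lambda>x. ennreal (h x))) (density M (\<lambda>x. ennreal (- h x)))"
  unfolding sr_rep_def
proof (intro conjI allI)
  show "radon (density M (\<lambda>x. ennreal (h x)))" "radon (density M (\<lambda>x. ennreal (- h x)))"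
    using M h by (simp_all add: radon_density loc_bounded_uminus)
  fix A
  show "sr_scale h (sr_of M) A = (if A \<in> rel_compact
      then measure (density M (\<lambda>x. ennreal (h x))) A - measure (density M (\<lambda>x. ennreal (- h x))) A else 0)"
  proof (cases "A \<in> rel_compact")
    case True
    have "integrable M (\<lambda>x. indicator A x * h x)"
      using M h True by (rule integrable_indicator_mult)
    then show ?thesis
      using True M h by (simp add: sr_scale_sr_of measure_density_loc_bounded loc_bounded_uminus
          real_lebesgue_integral_def)
  qed (simp add: sr_scale_def)
qed

lemma signed_radon_scale: "radon M \<Longrightarrow> loc_bounded h \<Longrightarrow> signed_radon (sr_scale h (sr_of M))"
  unfolding signed_radon_def using sr_rep_scale by blast

text \<open>Makes the truncation by \<open>ennreal\<close> explicit, because the integration rules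
  for \<open>density\<close> ask for a nonnegative real density.\<close>

lemma density_max_0: "density M (\<lambda>x. ennreal (h x)) = density M (\<lambda>x. ennreal (max 0 (h x)))"
proof -
  have "ennreal (h x) = ennreal (max 0 (h x))" for x
    by (simp add: max_def ennreal_neg)
  then show ?thesis by (simp only:)
qed

lemma has_sr_integral_scale:
  assumes M: "radon M" and h: "loc_bounded h" and F: "F \<in> borel_measurable opq_borel"
    and i: "integrable M (\<lambda>x. h x * F x)"
  shows "has_sr_integral (sr_scale h (sr_of M)) F (LINT x|M. h x * F x)"
proof -
  have [measurable]: "h \<in> borel_measurable M" "F \<in> borel_measurable M"
    using loc_bounded_measurable[OF M h] F by (simp_all add: radon_measurable[OF M])
  have p: "integrable M (\<lambda>x. max 0 (h x) * F x)" "integrable M (\<lambda>x. max 0 (- h x) * F x)"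
    by (rule Bochner_Integration.integrable_bound[OF i]; auto simp: abs_mult intro!: AE_I2 mult_right_mono)+
  have d: "integrable (density M (\<lambda>x. ennreal (g x))) F \<and>
      (LINT x|density M (\<lambda>x. ennreal (g x)). F x) = (LINT x|M. max 0 (g x) * F x)"
    if [measurable]: "g \<in> borel_measurable M" and "integrable M (\<lambda>x. max 0 (g x) * F x)" for g
    using that(2) unfolding density_max_0[of M g] by (simp add: integrable_density integral_density)
  have "(LINT x|M. h x * F x) = (LINT x|M. max 0 (h x) * F x - max 0 (- h x) * F x)"
    by (rule Bochner_Integration.integral_cong) (auto simp: max_def)
  also have "\<dots> = (LINT x|M. max 0 (h x) * F x) - (LINT x|M. max 0 (- h x) * F x)"
    by (rule Bochner_Integration.integral_diff[OF p])
  finally show ?thesis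
    unfolding has_sr_integral_def using sr_rep_scale[OF M h] d[of h] d[of "\<lambda>x. - h x"] p
    by (intro exI[of _ "density M (\<lambda>x. ennreal (h x))"] exI[of _ "density M (\<lambda>x. ennreal (- h x))"]) simp
qed

lemma sr_integral_scale:
  "radon M \<Longrightarrow> loc_bounded h \<Longrightarrow> F \<in> borel_measurable opq_borel \<Longrightarrow> integrable M (\<lambda>x. h x * F x) \<Longrightarrow>
    sr_integral (sr_scale h (sr_of M)) F = (LINT x|M. h x * F x)"
  by (intro sr_integral_eqI has_sr_integral_scale)

lemma sr_integral_scale_test_fun:
  "radon M \<Longrightarrow> loc_bounded h \<Longrightarrow> test_fun \<phi> \<Longrightarrow>
    sr_integral (sr_scale h (sr_of M)) \<phi> = (LINT x|M. h x * \<phi> x)"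
  using loc_bounded_test_fun[of \<phi>]
  by (intro sr_integral_scale integrable_mult_test_fun) (auto simp: loc_bounded_def)

text \<open>Associativity of multiplication by densities. It lets \<mu> act on the measure with
  density a weak derivative, whichever representative was chosen, and lets a / 2 act on a Hessian
  that is itself a density times arc length.\<close>

lemma sr_scale_sr_scale:
  assumes M: "radon M" and h: "loc_bounded h" and k: "loc_bounded k"
  shows "sr_scale h (sr_scale k (sr_of M)) = sr_scale (\<lambda>x. h x * k x) (sr_of M)"
proof
  fix A
  show "sr_scale h (sr_scale k (sr_of M)) A = sr_scale (\<lambda>x. h x * k x) (sr_of M) A"
  proof (cases "A \<in> rel_compact")
    case True
    have hk: "loc_bounded (\<lambda>x. h x * k x)"
      using h k by (rule loc_bounded_mult)
    have e: "(\<lambda>x. k x * (indicator A x * h x)) = (\<lambda>x. indicator A x * (h x * k x))"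
      by (simp add: ac_simps)
    have "loc_bounded (\<lambda>x. indicator A x * h x)"
      using h True by (intro loc_bounded_mult loc_bounded_indicator)
    then have "sr_integral (sr_scale k (sr_of M)) (\<lambda>x. indicator A x * h x) =
        (LINT x|M. k x * (indicator A x * h x))"
      using integrable_indicator_mult[OF M hk True] M k
      by (intro sr_integral_scale) (simp_all add: e loc_bounded_def)
    then show ?thesis
      using True M hk by (simp only: e sr_scale_sr_of) (simp add: sr_scale_def)
  qed (simp add: sr_scale_def)
qed

text \<open>For a density of constant sign one of the two parts of the representation vanishes, so that
  every other representation dominates it.\<close>

lemma sr_integrable_scale_nonpos_iff:
  assumes M: "radon M" and h: "loc_bounded h" "\<And>x. x \<in> opq \<Longrightarrow> h x \<le> 0"
    and F: "F \<in> borel_measurable opq_borel"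
  shows "sr_integrable (sr_scale h (sr_of M)) F \<longleftrightarrow> integrable M (\<lambda>x. h x * F x)"
proof
  assume "integrable M (\<lambda>x. h x * F x)"
  then show "sr_integrable (sr_scale h (sr_of M)) F"
    unfolding sr_integrable_def using has_sr_integral_scale[OF M h(1) F] by blast
next
  assume "sr_integrable (sr_scale h (sr_of M)) F"
  then obtain P N where PN: "sr_rep (sr_scale h (sr_of M)) P N" and i: "integrable P F" "integrable N F"
    by (auto simp: sr_integrable_def has_sr_integral_def)
  let ?P = "density M (\<lambda>x. ennreal (h x))" and ?N = "density M (\<lambda>x. ennreal (- h x))"
  have s: "sets P = sets M" "sets N = sets M"
    using M PN by (simp_all add: sr_rep_radon radon_sets)
  have m: "h \<in> borel_measurable M" "F \<in> borel_measurable M"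
    using loc_bounded_measurable[OF M h(1)] F by (simp_all add: radon_measurable[OF M])
  have "?P = density M (\<lambda>x. 0)"
    using h(2) m radon_space[OF M] by (intro density_cong AE_I2) (auto simp: ennreal_neg)
  then have "integrable ?P F"
    using m by (simp add: integrable_iff_bounded nn_integral_density)
  then have "integrable (measure_add ?P N) F"
    using i s by (subst integrable_measure_add) simp_all
  \<comment> \<open>The two crosswise sums are the same measure, so integrability against
    \<open>?P\<close> and \<open>N\<close> passes to \<open>P\<close> and \<open>?N\<close>.\<close>
  then have "integrable (measure_add P ?N) F"
    using sr_rep_measure_add_eq[OF PN sr_rep_scale[OF M h(1)]] by simp
  then have "integrable ?N F"
    using s by (subst (asm) integrable_measure_add) simp_all
  moreover have "AE x in M. 0 \<le> - h x"
    using h(2) radon_space[OF M] by (intro AE_I2) simp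
  ultimately have "integrable M (\<lambda>x. - h x *\<^sub>R F x)"
    using m by (subst (asm) integrable_density) simp_all
  then show "integrable M (\<lambda>x. h x * F x)"
    by simp
qed

lemma measure_measure_add:
  "radon M \<Longrightarrow> radon N \<Longrightarrow> A \<in> rel_compact \<Longrightarrow> measure (measure_add M N) A = measure M A + measure N A"
  using radon_rel_compact_finite[of M A] radon_rel_compact_finite[of N A]
  by (simp add: Sigma_Algebra.measure_def emeasure_measure_add radon_sets rel_compact_sets enn2real_plus)

lemma signed_radon_add:
  assumes "signed_radon \<nu>" "signed_radon \<nu>'"
  shows "signed_radon (\<lambda>A. \<nu> A + \<nu>' A)"
proof -
  obtain P N P' N' where rep: "sr_rep \<nu> P N" "sr_rep \<nu>' P' N'"
    using assms by (auto simp: signed_radon_def)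
  then have r: "radon P" "radon N" "radon P'" "radon N'"
    by (simp_all add: sr_rep_radon)
  have "\<nu> A + \<nu>' A = (if A \<in> rel_compact
      then measure (measure_add P P') A - measure (measure_add N N') A else 0)" for A
    using rep[THEN sr_rep_value, of A] rep[THEN sr_rep_outside, of A] r
    by (simp add: measure_measure_add)
  then have "sr_rep (\<lambda>A. \<nu> A + \<nu>' A) (measure_add P P') (measure_add N N')"
    unfolding sr_rep_def using r by (simp add: radon_measure_add)
  then show ?thesis
    unfolding signed_radon_def by blast
qed

text \<open>Second derivatives are signed measures and coincide by testing. For first derivatives
  the measures with densities \<open>g i\<close> and \<open>g' i\<close> coincide by testing, and
  the factor \<mu> is put in front afterwards; no pointwise comparison of the two representatives is
  made.\<close>

lemma is_distr_generator_unique: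
  assumes leb: "radon leb" and \<mu>: "\<And>i. loc_bounded (\<lambda>x. \<mu> x $ i)"
    and "is_distr_generator \<mu> \<sigma> f \<Lambda>" "is_distr_generator \<mu> \<sigma> f \<Lambda>'"
  shows "\<Lambda> = \<Lambda>'"
proof -
  obtain g \<nu> where g: "\<forall>i. bounded_weak_partial i f (g i)"
    and \<nu>: "\<forall>i j. measure_second_partial i j f (\<nu> i j)"
    and \<Lambda>: "\<forall>A. \<Lambda> A = (\<Sum>i\<in>UNIV. sr_scale (\<lambda>x. \<mu> x $ i * g i x) (sr_of leb) A) +
           (\<Sum>i\<in>UNIV. \<Sum>j\<in>UNIV. sr_scale (\<lambda>x. 1/2 * diffusion \<sigma> x $ i $ j) (\<nu> i j) A)"
    using assms(3) unfolding is_distr_generator_def by (elim exE conjE) (rule that)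
  obtain g' \<nu>' where g': "\<forall>i. bounded_weak_partial i f (g' i)"
    and \<nu>': "\<forall>i j. measure_second_partial i j f (\<nu>' i j)"
    and \<Lambda>': "\<forall>A. \<Lambda>' A = (\<Sum>i\<in>UNIV. sr_scale (\<lambda>x. \<mu> x $ i * g' i x) (sr_of leb) A) +
           (\<Sum>i\<in>UNIV. \<Sum>j\<in>UNIV. sr_scale (\<lambda>x. 1/2 * diffusion \<sigma> x $ i $ j) (\<nu>' i j) A)"
    using assms(4) unfolding is_distr_generator_def by (elim exE conjE) (rule that)
  have "\<nu> i j = \<nu>' i j" for i j
    using \<nu> \<nu>' by (intro signed_radon_eqI) (simp_all add: measure_second_partial_def)
  moreover have "sr_scale (\<lambda>x. \<mu> x $ i * g i x) (sr_of leb) = sr_scale (\<lambda>x. \<mu> x $ i * g' i x) (sr_of leb)" for i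
  proof -
    have lb: "loc_bounded (g i)" "loc_bounded (g' i)"
      using g g' by (simp_all add: bounded_weak_partial_def loc_bounded_bounded)
    have "sr_scale (g i) (sr_of leb) = sr_scale (g' i) (sr_of leb)"
    proof (rule signed_radon_eqI)
      fix \<phi> assume \<phi>: "test_fun \<phi>"
      then have "(LINT x|leb. g i x * \<phi> x) = (LINT x|leb. g' i x * \<phi> x)"
        using g g' by (simp add: bounded_weak_partial_def)
      then show "sr_integral (sr_scale (g i) (sr_of leb)) \<phi> = sr_integral (sr_scale (g' i) (sr_of leb)) \<phi>"
        using leb lb \<phi> by (simp add: sr_integral_scale_test_fun)
    qed (use leb lb in \<open>simp_all add: signed_radon_scale\<close>)
    then show ?thesis
      using leb lb \<mu> by (simp flip: sr_scale_sr_scale)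
  qed
  ultimately show ?thesis
    using \<Lambda> \<Lambda>' by (intro ext) simp
qed

subsection \<open>Integration by parts along coordinate lines\<close>

lemma vector2_eq_axis: "(vector [s, t] :: real^2) = s *\<^sub>R axis 1 1 + t *\<^sub>R axis 2 1"
  by (simp add: vec_eq_iff forall_2 axis_def)

lemma vector2_measurable [measurable]:
  "(\<lambda>(s, t). vector [s, t] :: real^2) \<in> borel_measurable (lborel \<Otimes>\<^sub>M lborel)"
  unfolding vector2_eq_axis by measurable

text \<open>The bridge from \<open>real^2\<close> to a product of two lines, where Fubini is
  available; Lebesgue measure is recognised by the volumes of boxes.\<close>

lemma lborel_vector2:
  "(lborel :: (real^2) measure) = distr (lborel \<Otimes>\<^sub>M lborel) borel (\<lambda>(s, t). vector [s, t])"
proof (rule lborel_eqI)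
  fix l u :: "real^2"
  assume lu: "\<And>b. b \<in> Basis \<Longrightarrow> l \<bullet> b \<le> u \<bullet> b"
  have B: "(Basis :: (real^2) set) = {axis 1 1, axis 2 1}"
    unfolding Basis_vec_def by (auto simp: UNIV_2)
  have ne: "(axis 1 1 :: real^2) \<noteq> axis 2 1"
    by (simp add: axis_eq_axis)
  have le: "l $ 1 \<le> u $ 1" "l $ 2 \<le> u $ 2"
    using lu[of "axis 1 1"] lu[of "axis 2 1"] by (simp_all add: B inner_axis)
  have "(\<lambda>(s, t). vector [s, t]) -` box l u = {l $ 1<..<u $ 1} \<times> {l $ 2<..<u $ 2}"
    by (auto simp: mem_box_cart forall_2)
  then have "emeasure (distr (lborel \<Otimes>\<^sub>M lborel) borel (\<lambda>(s, t). vector [s, t])) (box l u) =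
      emeasure (lborel \<Otimes>\<^sub>M lborel) ({l $ 1<..<u $ 1} \<times> {l $ 2<..<u $ 2})"
    by (subst emeasure_distr) (auto simp: space_pair_measure)
  also have "\<dots> = ennreal (u $ 1 - l $ 1) * ennreal (u $ 2 - l $ 2)"
    using le by (subst lborel.emeasure_pair_measure_Times) simp_all
  also have "\<dots> = (\<Prod>b\<in>Basis. (u - l) \<bullet> b)"
    using le ne unfolding B by (simp add: inner_axis ennreal_mult)
  finally show "emeasure (distr (lborel \<Otimes>\<^sub>M lborel) borel (\<lambda>(s, t). vector [s, t])) (box l u) =
      (\<Prod>b\<in>Basis. (u - l) \<bullet> b)" .
qed simp

text \<open>Both orders are needed: the inner integral must run in the direction of the derivative
  that is to be removed.\<close>

lemma integral_vector2:
  fixes F :: "real^2 \<Rightarrow> real"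
  assumes F: "integrable lborel F"
  shows "(LINT x|lborel. F x) = (LINT t|lborel. LINT s|lborel. F (vector [s, t]))"
    and "(LINT x|lborel. F x) = (LINT s|lborel. LINT t|lborel. F (vector [s, t]))"
proof -
  have m: "F \<in> borel_measurable borel"
    using F by simp
  have "integrable (distr (lborel \<Otimes>\<^sub>M lborel) borel (\<lambda>(s, t). vector [s, t])) F"
    using F by (simp flip: lborel_vector2)
  then have "integrable (lborel \<Otimes>\<^sub>M lborel) (\<lambda>p. F (case p of (s, t) \<Rightarrow> vector [s, t]))"
    by (subst (asm) integrable_distr_eq) (use m in simp_all)
  then have i: "integrable (lborel \<Otimes>\<^sub>M lborel) (case_prod (\<lambda>s t. F (vector [s, t])))"
    by (simp add: split_def)
  have "(LINT x|lborel. F x) = (LINT p|(lborel \<Otimes>\<^sub>M lborel). F (case p of (s, t) \<Rightarrow> vector [s, t]))"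
    by (subst lborel_vector2, subst integral_distr) (use m in simp_all)
  then have e: "(LINT x|lborel. F x) = integral\<^sup>L (lborel \<Otimes>\<^sub>M lborel) (case_prod (\<lambda>s t. F (vector [s, t])))"
    by (simp add: split_def)
  show "(LINT x|lborel. F x) = (LINT t|lborel. LINT s|lborel. F (vector [s, t]))"
    unfolding e using lborel_pair.integral_snd[OF i] by simp
  show "(LINT x|lborel. F x) = (LINT s|lborel. LINT t|lborel. F (vector [s, t]))"
    unfolding e using lborel_pair.integral_fst[OF i] by simp
qed

lemma integrable_continuous_supp:
  fixes f :: "real \<Rightarrow> real"
  assumes "continuous_on UNIV f" "\<And>t. B < \<bar>t\<bar> \<Longrightarrow> f t = 0"
  shows "integrable lborel f"
proof -
  have "integrable lborel (\<lambda>x. indicator {-B..B} x *\<^sub>R f x)"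
    by (rule borel_integrable_compact) (use assms(1) in \<open>auto intro: continuous_on_subset\<close>)
  moreover have "(\<lambda>x. indicator {-B..B} x *\<^sub>R f x) = f"
    using assms(2) by (auto simp: fun_eq_iff split: split_indicator)
  ultimately show ?thesis by simp
qed

context
  fixes u u' :: "real \<Rightarrow> real" and B :: real
  assumes deriv: "\<And>t. (u has_field_derivative u' t) (at t)"
    and cont: "continuous_on UNIV u'"
    and supp: "\<And>t. B < \<bar>t\<bar> \<Longrightarrow> u t = 0" "\<And>t. B < \<bar>t\<bar> \<Longrightarrow> u' t = 0"
begin

lemma isCont_derivative: "isCont u' t"
  using cont by (simp add: continuous_on_eq_continuous_at)

lemma integral_deriv_greaterThan: "(LINT t|lborel. indicator {c<..} t * u' t) = - u c"
proof -
  \<comment> \<open>A point to the right of \<open>c\<close> and beyond the support; the absolute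
    value guards against a negative \<open>B\<close>.\<close>
  let ?b = "\<bar>c\<bar> + \<bar>B\<bar> + 1"
  have [measurable]: "u' \<in> borel_measurable borel"
    using cont by (rule borel_measurable_continuous_onI)
  \<comment> \<open>The half-line and the closed interval differ at the null point \<open>c\<close>
    and beyond \<open>?b\<close>, where \<open>u'\<close> vanishes.\<close>
  have "AE t in lborel. indicator {c<..} t * u' t = u' t * indicator {c..?b} t"
    using AE_lborel_singleton[of c]
  proof eventually_elim
    case (elim t)
    then show ?case
      using supp(2)[of t] by (auto split: split_indicator)
  qed
  then have "(LINT t|lborel. indicator {c<..} t * u' t) = (LINT t|lborel. u' t * indicator {c..?b} t)"
    by (intro integral_cong_AE) simp_all
  also have "\<dots> = u ?b - u c"
    by (rule integral_FTC_Icc_real) (auto intro: deriv isCont_derivative)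
  also have "u ?b = 0"
    by (rule supp) simp
  finally show ?thesis by simp
qed

lemma integral_deriv_lessThan: "(LINT t|lborel. indicator {..<c} t * u' t) = u c"
proof -
  let ?a = "- (\<bar>c\<bar> + \<bar>B\<bar> + 1)"
  have [measurable]: "u' \<in> borel_measurable borel"
    using cont by (rule borel_measurable_continuous_onI)
  have "AE t in lborel. indicator {..<c} t * u' t = u' t * indicator {?a..c} t"
    using AE_lborel_singleton[of c]
  proof eventually_elim
    case (elim t)
    then show ?case
      using supp(2)[of t] by (auto split: split_indicator)
  qed
  then have "(LINT t|lborel. indicator {..<c} t * u' t) = (LINT t|lborel. u' t * indicator {?a..c} t)"
    by (intro integral_cong_AE) simp_all
  also have "\<dots> = u c - u ?a"
    by (rule integral_FTC_Icc_real) (auto intro: deriv isCont_derivative)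
  also have "u ?a = 0"
    by (rule supp) simp
  finally show ?thesis by simp
qed

lemma integral_deriv_eq_0: "(LINT t|lborel. u' t) = 0"
proof -
  let ?b = "\<bar>B\<bar> + 1"
  have "(LINT t|lborel. u' t) = (LINT t|lborel. indicator {- ?b<..} t * u' t)"
    using supp(2) by (intro Bochner_Integration.integral_cong) (auto split: split_indicator)
  also have "\<dots> = 0"
    unfolding integral_deriv_greaterThan using supp(1)[of "- ?b"] by simp
  finally show ?thesis .
qed

lemma integrable_primitive: "integrable lborel u" and integrable_derivative: "integrable lborel u'"
proof -
  have "continuous_on UNIV u"
    using deriv by (intro DERIV_continuous_on) (auto intro: has_field_derivative_at_within)
  then show "integrable lborel u"
    using supp(1) by (rule integrable_continuous_supp)
  show "integrable lborel u'"
    using cont supp(2) by (rule integrable_continuous_supp)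
qed

end

text \<open>Write max t c = c + (t - c)^+. The constant contributes nothing because
  \<open>u'\<close> has integral 0. On (c, \<infinity>) the product (t - c) u has derivative u + (t
  - c) u' and vanishes at both ends, so these two terms cancel under the integral.\<close>

lemma integral_max_mult_deriv:
  fixes u u' :: "real \<Rightarrow> real" and B c :: real
  assumes deriv: "\<And>t. (u has_field_derivative u' t) (at t)"
    and cont: "continuous_on UNIV u'"
    and supp: "\<And>t. B < \<bar>t\<bar> \<Longrightarrow> u t = 0" "\<And>t. B < \<bar>t\<bar> \<Longrightarrow> u' t = 0"
  shows "(LINT t|lborel. max t c * u' t) = - (LINT t|lborel. indicator {c<..} t * u t)"
proof -
  note iu = integrable_primitive[OF deriv cont supp] integrable_derivative[OF deriv cont supp]
  have contu: "continuous_on UNIV u"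
    using deriv by (intro DERIV_continuous_on) (auto intro: has_field_derivative_at_within)
  let ?I = "\<lambda>t. indicator {c<..} t :: real"
  have d: "((\<lambda>t. (t - c) * u t) has_field_derivative u t + (t - c) * u' t) (at t)" for t
    using DERIV_mult[OF DERIV_diff[OF DERIV_ident DERIV_const[of c]] deriv[of t]]
    by (simp add: mult.commute)
  have "continuous_on UNIV (\<lambda>t. u t + (t - c) * u' t)"
    by (intro continuous_intros contu cont)
  from integral_deriv_greaterThan[OF d this, of B c]
  have 1: "(LINT t|lborel. ?I t * (u t + (t - c) * u' t)) = 0"
    using supp by simp
  have "integrable lborel (\<lambda>t. (t - c) * u' t)"
    by (rule integrable_continuous_supp[of _ B]) (use supp in \<open>auto intro!: continuous_intros cont\<close>)
  then have i: "integrable lborel (\<lambda>t. ?I t * u t)" "integrable lborel (\<lambda>t. ?I t * ((t - c) * u' t))"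
    using iu(1) by (simp_all add: integrable_real_mult_indicator mult.commute[of "?I _"])
  have "(LINT t|lborel. ?I t * u t) + (LINT t|lborel. ?I t * ((t - c) * u' t)) = 0"
    using 1 i by (simp add: distrib_left flip: Bochner_Integration.integral_add)
  moreover have "(LINT t|lborel. max t c * u' t) = (LINT t|lborel. c * u' t + ?I t * ((t - c) * u' t))"
    by (rule Bochner_Integration.integral_cong) (auto simp: max_def algebra_simps split: split_indicator)
  moreover have "\<dots> = c * (LINT t|lborel. u' t) + (LINT t|lborel. ?I t * ((t - c) * u' t))"
    using i iu by (subst Bochner_Integration.integral_add) simp_all
  ultimately show ?thesis
    by (simp add: integral_deriv_eq_0[OF deriv cont supp])
qed

lemma smooth_fun_partial: "smooth_fun f \<Longrightarrow> smooth_fun (partial i f)"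
  unfolding smooth_fun_def
proof
  fix "is"
  assume "\<forall>is. foldr partial is f differentiable_on UNIV"
  then have "foldr partial (is @ [i]) f differentiable_on UNIV"
    by (rule spec)
  then show "foldr partial is (partial i f) differentiable_on UNIV"
    by simp
qed

lemma partial_eq_0_outside:
  assumes "closed K" "\<And>x. x \<notin> K \<Longrightarrow> f x = 0" "x \<notin> K"
  shows "partial i f x = 0"
  using partial_cong_open[of "- K" x f "\<lambda>x. 0" i] assms by (simp add: partial_const open_Compl)

lemma test_fun_partial:
  assumes "test_fun \<phi>"
  shows "test_fun (partial i \<phi>)"
proof -
  obtain K where K: "compact K" "K \<subseteq> opq" "\<And>x. x \<notin> K \<Longrightarrow> \<phi> x = 0"
    using assms unfolding test_fun_def by blast
  have "partial i \<phi> x = 0" if "x \<notin> K" for x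
    using partial_eq_0_outside[OF compact_imp_closed[OF K(1)] K(3) that] .
  then show ?thesis
    using assms K(1,2) smooth_fun_partial unfolding test_fun_def by blast
qed

lemma test_fun_outside: "test_fun \<phi> \<Longrightarrow> x \<notin> opq \<Longrightarrow> \<phi> x = 0"
  unfolding test_fun_def by blast

lemma test_fun_bounded_supp:
  assumes "test_fun \<phi>"
  obtains B where "\<And>x i. B < \<bar>x $ i\<bar> \<Longrightarrow> \<phi> x = 0" "\<And>x i j. B < \<bar>x $ i\<bar> \<Longrightarrow> partial j \<phi> x = 0"
proof -
  obtain K where K: "compact K" "\<And>x. x \<notin> K \<Longrightarrow> \<phi> x = 0"
    using assms unfolding test_fun_def by blast
  obtain B where B: "\<And>x. x \<in> K \<Longrightarrow> norm x \<le> B"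
    using compact_imp_bounded[OF K(1)] unfolding bounded_iff by auto
  have n: "x \<notin> K" if "B < \<bar>x $ i\<bar>" for x i
    using that B[of x] component_le_norm_cart[of x i] by linarith
  show thesis
  proof (rule that)
    show "\<phi> x = 0" if "B < \<bar>x $ i\<bar>" for x i
      using K(2) n[OF that] by simp
    show "partial j \<phi> x = 0" if "B < \<bar>x $ i\<bar>" for x i j
      using partial_eq_0_outside[OF compact_imp_closed[OF K(1)] K(2) n[OF that]] .
  qed
qed

lemma test_fun_differentiable:
  assumes "test_fun \<phi>"
  shows "\<phi> differentiable (at x)"
proof -
  have "foldr partial [] \<phi> differentiable_on UNIV"
    using assms unfolding test_fun_def smooth_fun_def by blast
  then show ?thesis
    by (simp add: differentiable_on_def)
qed

lemma test_fun_slice_DERIV: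
  assumes "test_fun \<phi>"
  shows "((\<lambda>s. \<phi> (vector [s, t])) has_field_derivative partial 1 \<phi> (vector [s, t])) (at s)"
    and "((\<lambda>t. \<phi> (vector [s, t])) has_field_derivative partial 2 \<phi> (vector [s, t])) (at t)"
proof -
  have "((\<lambda>h. \<phi> (vector [s, t] + h *\<^sub>R axis i 1)) has_field_derivative partial i \<phi> (vector [s, t])) (at 0)" for i
    by (rule partial_DERIV[OF test_fun_differentiable[OF assms]])
  from this[of 1] this[of 2]
  have "((\<lambda>h. \<phi> (vector [h + s, t])) has_field_derivative partial 1 \<phi> (vector [s, t])) (at 0)"
    "((\<lambda>h. \<phi> (vector [s, h + t])) has_field_derivative partial 2 \<phi> (vector [s, t])) (at 0)"
    by (simp_all add: vector2_eq_axis algebra_simps)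
  then show "((\<lambda>s. \<phi> (vector [s, t])) has_field_derivative partial 1 \<phi> (vector [s, t])) (at s)"
    "((\<lambda>t. \<phi> (vector [s, t])) has_field_derivative partial 2 \<phi> (vector [s, t])) (at t)"
    using DERIV_shift[of "\<lambda>s. \<phi> (vector [s, t])" _ 0 s] DERIV_shift[of "\<lambda>t. \<phi> (vector [s, t])" _ 0 t]
    by simp_all
qed

lemma test_fun_slice_continuous:
  assumes "test_fun \<phi>"
  shows "continuous_on UNIV (\<lambda>s. \<phi> (vector [s, t]))" "continuous_on UNIV (\<lambda>t. \<phi> (vector [s, t]))"
  unfolding vector2_eq_axis
  by (rule continuous_on_compose2[OF test_fun_continuous[OF assms, of UNIV]];
      auto intro!: continuous_intros)+

lemma radon_leb: "radon leb"
  unfolding radon_def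
proof (intro conjI allI impI)
  show "sets leb = sets opq_borel"
    unfolding leb_def by (rule sets_restrict_space_cong) simp
  fix K :: "(real^2) set"
  assume K: "compact K \<and> K \<subseteq> opq"
  then have "emeasure leb K = emeasure lborel K"
    unfolding leb_def by (subst emeasure_restrict_space) auto
  then show "emeasure leb K < \<infinity>"
    using K emeasure_bounded_finite[of K] by (simp add: compact_imp_bounded)
qed

lemma leb_eq_lborel:
  fixes f :: "real^2 \<Rightarrow> real"
  assumes "\<And>x. x \<notin> opq \<Longrightarrow> f x = 0"
  shows "(LINT x|leb. f x) = (LINT x|lborel. f x)" "integrable leb f \<longleftrightarrow> integrable lborel f"
proof -
  have "(\<lambda>x. indicator opq x *\<^sub>R f x) = f"
    using assms by (auto simp: fun_eq_iff split: split_indicator)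
  then show "(LINT x|leb. f x) = (LINT x|lborel. f x)" "integrable leb f \<longleftrightarrow> integrable lborel f"
    unfolding leb_def by (simp_all add: integral_restrict_space integrable_restrict_space)
qed

text \<open>Test functions vanish outside the quadrant, so slices may run over whole lines and no
  boundary terms arise at the axes.\<close>

lemma integral_leb_vector2:
  assumes "loc_bounded h" "test_fun \<phi>"
  shows "(LINT x|leb. h x * \<phi> x) = (LINT t|lborel. LINT s|lborel. h (vector [s, t]) * \<phi> (vector [s, t]))"
    and "(LINT x|leb. h x * \<phi> x) = (LINT s|lborel. LINT t|lborel. h (vector [s, t]) * \<phi> (vector [s, t]))"
proof -
  have z: "h x * \<phi> x = 0" if "x \<notin> opq" for x
    using test_fun_outside[OF assms(2) that] by simp
  have "integrable lborel (\<lambda>x. h x * \<phi> x)"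
    using integrable_mult_test_fun[OF radon_leb assms] leb_eq_lborel(2)[of "\<lambda>x. h x * \<phi> x", OF z] by simp
  from integral_vector2[OF this]
  show "(LINT x|leb. h x * \<phi> x) = (LINT t|lborel. LINT s|lborel. h (vector [s, t]) * \<phi> (vector [s, t]))"
    "(LINT x|leb. h x * \<phi> x) = (LINT s|lborel. LINT t|lborel. h (vector [s, t]) * \<phi> (vector [s, t]))"
    using leb_eq_lborel(1)[of "\<lambda>x. h x * \<phi> x", OF z] by simp_all
qed

subsection \<open>Distributional derivatives of the reward\<close>

text \<open>The strict inequalities leave the value 0 on the null set \<Delta> and make every slice
  a multiple of the indicator of an open half-line.\<close>

definition reward_grad :: "real \<Rightarrow> 2 \<Rightarrow> real^2 \<Rightarrow> real" where
  "reward_grad \<alpha> i x = (if i = 1 then indicator {x. \<alpha> * x $ 2 < x $ 1} x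
     else \<alpha> * indicator {x. x $ 1 < \<alpha> * x $ 2} x)"

lemma component_borel_measurable [measurable]: "(\<lambda>x::real^2. x $ i) \<in> borel_measurable borel"
  by (intro borel_measurable_continuous_onI continuous_intros)

lemma reward_grad_measurable: "reward_grad \<alpha> i \<in> borel_measurable opq_borel"
proof (rule measurable_restrict_space1)
  show "reward_grad \<alpha> i \<in> borel_measurable borel"
    unfolding reward_grad_def[abs_def] by (cases "i = 1") simp_all
qed

lemma reward_grad_bounded: "bounded (reward_grad \<alpha> i ` opq)"
  unfolding bounded_iff
  by (rule exI[of _ "1 + \<bar>\<alpha>\<bar>"]) (auto simp: reward_grad_def split: split_indicator)

lemma loc_bounded_reward_grad: "loc_bounded (reward_grad \<alpha> i)"
  by (intro loc_bounded_bounded reward_grad_measurable reward_grad_bounded)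

lemma loc_bounded_reward: "loc_bounded (reward \<alpha>)"
  unfolding reward_def[abs_def] by (intro loc_bounded_continuous continuous_intros)

text \<open>The first pair moves one derivative from a test function onto the reward; the other two
  pairs evaluate the jump of its gradient where a line crosses \<Delta>.\<close>

lemma slice_integrals:
  assumes \<phi>: "test_fun \<phi>"
  shows "(LINT s|lborel. max s c * partial 1 \<phi> (vector [s, t])) =
      - (LINT s|lborel. indicator {c<..} s * \<phi> (vector [s, t]))"
    and "(LINT t|lborel. max t c * partial 2 \<phi> (vector [s, t])) =
      - (LINT t|lborel. indicator {c<..} t * \<phi> (vector [s, t]))"
    and "(LINT s|lborel. indicator {c<..} s * partial 1 \<phi> (vector [s, t])) = - \<phi> (vector [c, t])"
    and "(LINT t|lborel. indicator {c<..} t * partial 2 \<phi> (vector [s, t])) = - \<phi> (vector [s, c])"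
    and "(LINT s|lborel. indicator {..<c} s * partial 1 \<phi> (vector [s, t])) = \<phi> (vector [c, t])"
    and "(LINT t|lborel. indicator {..<c} t * partial 2 \<phi> (vector [s, t])) = \<phi> (vector [s, c])"
proof -
  obtain B where B: "\<And>x i. B < \<bar>x $ i\<bar> \<Longrightarrow> \<phi> x = 0" "\<And>x i j. B < \<bar>x $ i\<bar> \<Longrightarrow> partial j \<phi> x = 0"
    using test_fun_bounded_supp[OF \<phi>] by metis
  have c1: "continuous_on UNIV (\<lambda>s. partial 1 \<phi> (vector [s, t]))" for t
    by (rule test_fun_slice_continuous[OF test_fun_partial[OF \<phi>]])
  have c2: "continuous_on UNIV (\<lambda>t. partial 2 \<phi> (vector [s, t]))" for s
    by (rule test_fun_slice_continuous[OF test_fun_partial[OF \<phi>]])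
  have s1: "\<phi> (vector [s, t]) = 0" "partial 1 \<phi> (vector [s, t]) = 0" if "B < \<bar>s\<bar>" for s t
    using B(1)[of "vector [s, t]" 1] B(2)[of "vector [s, t]" 1] that by simp_all
  have s2: "\<phi> (vector [s, t]) = 0" "partial 2 \<phi> (vector [s, t]) = 0" if "B < \<bar>t\<bar>" for s t
    using B(1)[of "vector [s, t]" 2] B(2)[of "vector [s, t]" 2] that by simp_all
  note d1 = test_fun_slice_DERIV(1)[OF \<phi>] and d2 = test_fun_slice_DERIV(2)[OF \<phi>]
  show "(LINT s|lborel. max s c * partial 1 \<phi> (vector [s, t])) =
      - (LINT s|lborel. indicator {c<..} s * \<phi> (vector [s, t]))"
    by (rule integral_max_mult_deriv[OF d1 c1 s1])
  show "(LINT t|lborel. max t c * partial 2 \<phi> (vector [s, t])) =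
      - (LINT t|lborel. indicator {c<..} t * \<phi> (vector [s, t]))"
    by (rule integral_max_mult_deriv[OF d2 c2 s2])
  show "(LINT s|lborel. indicator {c<..} s * partial 1 \<phi> (vector [s, t])) = - \<phi> (vector [c, t])"
    by (rule integral_deriv_greaterThan[OF d1 c1 s1])
  show "(LINT t|lborel. indicator {c<..} t * partial 2 \<phi> (vector [s, t])) = - \<phi> (vector [s, c])"
    by (rule integral_deriv_greaterThan[OF d2 c2 s2])
  show "(LINT s|lborel. indicator {..<c} s * partial 1 \<phi> (vector [s, t])) = \<phi> (vector [c, t])"
    by (rule integral_deriv_lessThan[OF d1 c1 s1])
  show "(LINT t|lborel. indicator {..<c} t * partial 2 \<phi> (vector [s, t])) = \<phi> (vector [s, c])"
    by (rule integral_deriv_lessThan[OF d2 c2 s2])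
qed

text \<open>In the second form \<alpha> is pulled out so that the slice in \<open>t\<close> is again
  a maximum with a constant, with kink at s / \<alpha>.\<close>

lemma reward_slice: "reward \<alpha> (vector [s, t]) = max s (\<alpha> * t)"
  "\<alpha> > 0 \<Longrightarrow> reward \<alpha> (vector [s, t]) = \<alpha> * max t (s / \<alpha>)"
  by (simp_all add: reward_def max_def field_simps)

lemma reward_grad_slice:
  "reward_grad \<alpha> 1 (vector [s, t]) = indicator {\<alpha> * t<..} s"
  "reward_grad \<alpha> 2 (vector [s, t]) = \<alpha> * indicator {..<\<alpha> * t} s"
  "\<alpha> > 0 \<Longrightarrow> reward_grad \<alpha> 1 (vector [s, t]) = indicator {..<s / \<alpha>} t"
  "\<alpha> > 0 \<Longrightarrow> reward_grad \<alpha> 2 (vector [s, t]) = \<alpha> * indicator {s / \<alpha><..} t"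
  by (auto simp: reward_grad_def field_simps split: split_indicator)

lemma weak_partial_reward:
  assumes \<alpha>: "\<alpha> > 0" and \<phi>: "test_fun \<phi>"
  shows "(LINT x|leb. reward_grad \<alpha> i x * \<phi> x) = - (LINT x|leb. reward \<alpha> x * partial i \<phi> x)"
proof -
  note p = test_fun_partial[OF \<phi>]
  consider "i = 1" | "i = 2" using exhaust_2 by blast
  then show ?thesis
  proof cases
    case 1
    show ?thesis
      unfolding 1 integral_leb_vector2(1)[OF loc_bounded_reward_grad \<phi>]
        integral_leb_vector2(1)[OF loc_bounded_reward p]
      by (simp add: reward_slice(1) reward_grad_slice(1) slice_integrals[OF \<phi>])
  next
    case 2
    show ?thesis
      unfolding 2 integral_leb_vector2(2)[OF loc_bounded_reward_grad \<phi>]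
        integral_leb_vector2(2)[OF loc_bounded_reward p]
      using \<alpha> by (simp add: reward_slice(2) reward_grad_slice(4) slice_integrals[OF \<phi>] mult.assoc)
  qed
qed

lemma normal_vec_component: "normal_vec \<alpha> $ 1 = 1" "normal_vec \<alpha> $ 2 = - \<alpha>"
  by (simp_all add: normal_vec_def)

text \<open>Every line in direction \<open>j\<close> crosses \<Delta> exactly once, and
  \<open>reward_grad \<alpha> i\<close> jumps there by \<open>normal_vec \<alpha> $ i\<close>, up to
  the sign given by the direction of crossing. The remaining integral runs over the crossing
  points.\<close>

lemma integral_reward_grad_partial:
  assumes \<alpha>: "\<alpha> > 0" and \<phi>: "test_fun \<phi>"
  shows "(LINT x|leb. reward_grad \<alpha> i x * partial j \<phi> x) =
    - (normal_vec \<alpha> $ i * normal_vec \<alpha> $ j * (LINT t|lborel. \<phi> (vector [\<alpha> * t, t])))"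
proof -
  note f = integral_leb_vector2[OF loc_bounded_reward_grad test_fun_partial[OF \<phi>]]
  \<comment> \<open>Vertical lines meet \<Delta> at t = s / \<alpha>. Substituting s = \<alpha> t
    returns to the parameter used for horizontal lines and supplies the factor \<alpha> in the
    second component of the normal.\<close>
  have J: "(LINT s|lborel. \<phi> (vector [s, s / \<alpha>])) = \<alpha> * (LINT t|lborel. \<phi> (vector [\<alpha> * t, t]))"
    using \<alpha> lborel_integral_real_affine[of \<alpha> "\<lambda>s. \<phi> (vector [s, s / \<alpha>])" 0] by simp
  consider "i = 1" "j = 1" | "i = 1" "j = 2" | "i = 2" "j = 1" | "i = 2" "j = 2"
    using exhaust_2 by blast
  then show ?thesis
  proof cases
    case 1
    show ?thesis
      unfolding 1 f(1) by (simp add: reward_grad_slice(1) slice_integrals[OF \<phi>] normal_vec_component)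
  next
    case 2
    show ?thesis
      unfolding 2 f(2) using \<alpha>
      by (simp add: reward_grad_slice(3) slice_integrals[OF \<phi>] normal_vec_component J)
  next
    case 3
    show ?thesis
      unfolding 3 f(1) by (simp add: reward_grad_slice(2) slice_integrals[OF \<phi>] normal_vec_component mult.assoc)
  next
    case 4
    show ?thesis
      unfolding 4 f(2) using \<alpha>
      by (simp add: reward_grad_slice(4) slice_integrals[OF \<phi>] normal_vec_component J mult.assoc)
  qed
qed

section \<open>Arc length on the diagonal\<close>

lemma arc_param_measurable:
  assumes "\<alpha> > 0"
  shows "(\<lambda>t. (t / sqrt (1 + \<alpha>\<^sup>2)) *\<^sub>R vector [\<alpha>, 1]) \<in> measurable (restrict_space lborel {0<..}) opq_borel"
proof (rule measurable_restrict_space2)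
  show "(\<lambda>t. (t / sqrt (1 + \<alpha>\<^sup>2)) *\<^sub>R vector [\<alpha>, 1] :: real^2) \<in> borel_measurable (restrict_space lborel {0<..})"
    by (rule measurable_restrict_space1) simp
  have "0 < 1 + \<alpha>\<^sup>2"
    by (simp add: add_pos_nonneg)
  then show "(\<lambda>t. (t / sqrt (1 + \<alpha>\<^sup>2)) *\<^sub>R vector [\<alpha>, 1]) \<in> space (restrict_space lborel {0<..}) \<rightarrow> opq"
    using assms by (auto simp: space_restrict_space opq_def)
qed

lemma radon_arc_length:
  assumes \<alpha>: "\<alpha> > 0"
  shows "radon (arc_length \<alpha>)"
  unfolding radon_def
proof (intro conjI allI impI)
  show "sets (arc_length \<alpha>) = sets opq_borel"
    by (simp add: arc_length_def)
  fix K assume K: "compact K \<and> K \<subseteq> opq"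
  define R where "R = sqrt (1 + \<alpha>\<^sup>2)"
  have R: "R > 0"
    unfolding R_def by (simp add: add_pos_nonneg)
  obtain B where B: "\<And>x. x \<in> K \<Longrightarrow> norm x \<le> B"
    using K compact_imp_bounded[of K] unfolding bounded_iff by auto
  let ?f = "\<lambda>t. (t / R) *\<^sub>R vector [\<alpha>, 1] :: real^2"
  let ?X = "?f -` K \<inter> space (restrict_space lborel {0<..})"
  have X: "?X \<in> sets (restrict_space lborel {0<..})"
    using arc_param_measurable[OF \<alpha>] compact_sets_opq_borel K unfolding R_def
    by (intro measurable_sets) auto
  \<comment> \<open>The second coordinate of the parametrization is t / R, so a bound on
    \<open>K\<close> confines the parameter to a bounded interval.\<close>
  have sub: "?X \<subseteq> {- (B * R)..B * R}"
  proof
    fix t assume t: "t \<in> ?X"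
    then have "\<bar>?f t $ 2\<bar> \<le> B"
      using B[of "?f t"] component_le_norm_cart[of "?f t" 2] by simp
    then show "t \<in> {- (B * R)..B * R}"
      using R by (auto simp: field_simps abs_le_iff)
  qed
  have "emeasure (arc_length \<alpha>) K = emeasure (restrict_space lborel {0<..}) ?X"
    unfolding arc_length_def R_def
    by (rule emeasure_distr[OF arc_param_measurable[OF \<alpha>]]) (use K compact_sets_opq_borel in blast)
  also have "\<dots> = emeasure lborel ?X"
    using X by (intro emeasure_restrict_space) (auto simp: space_restrict_space)
  also have "\<dots> \<le> emeasure lborel {- (B * R)..B * R}"
    by (rule emeasure_mono[OF sub]) simp
  also have "\<dots> < \<infinity>"
    by (simp add: emeasure_lborel_Icc_eq)
  finally show "emeasure (arc_length \<alpha>) K < \<infinity>" .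
qed

text \<open>Unit speed means x_2 = t / sqrt (1 + \<alpha>^2). Passing to x_2 as parameter produces
  the square root, which the Hessian of the reward divides out again.\<close>

lemma integral_arc_length_test_fun:
  assumes \<alpha>: "\<alpha> > 0" and \<phi>: "test_fun \<phi>"
  shows "(LINT x|arc_length \<alpha>. \<phi> x) = sqrt (1 + \<alpha>\<^sup>2) * (LINT t|lborel. \<phi> (vector [\<alpha> * t, t]))"
proof -
  define R where "R = sqrt (1 + \<alpha>\<^sup>2)"
  have R: "R > 0"
    unfolding R_def by (simp add: add_pos_nonneg)
  let ?f = "\<lambda>t. \<phi> ((t / R) *\<^sub>R vector [\<alpha>, 1])"
  have "(LINT x|arc_length \<alpha>. \<phi> x) = (LINT t|restrict_space lborel {0<..}. ?f t)"
    unfolding arc_length_def R_def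
    by (rule integral_distr[OF arc_param_measurable[OF \<alpha>]])
      (use loc_bounded_test_fun[OF \<phi>] in \<open>simp add: loc_bounded_def\<close>)
  also have "\<dots> = (LINT t|lborel. indicator {0<..} t *\<^sub>R ?f t)"
    by (rule integral_restrict_space) simp
  also have "\<dots> = (LINT t|lborel. ?f t)"
  proof (rule Bochner_Integration.integral_cong[OF refl])
    fix t :: real
    have "?f t = 0" if "t \<le> 0"
      using that R by (intro test_fun_outside[OF \<phi>]) (simp add: opq_def divide_le_0_iff not_less)
    then show "indicator {0<..} t *\<^sub>R ?f t = ?f t"
      by (simp split: split_indicator)
  qed
  also have "\<dots> = R * (LINT t|lborel. \<phi> (t *\<^sub>R vector [\<alpha>, 1]))"
    using R lborel_integral_real_affine[of R ?f 0] by simp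
  also have "(\<lambda>t. \<phi> (t *\<^sub>R vector [\<alpha>, 1])) = (\<lambda>t. \<phi> (vector [\<alpha> * t, t]))"
    by (simp add: vector2_eq_axis scaleR_add_right mult.commute)
  finally show ?thesis
    by (simp add: R_def)
qed

lemma bounded_weak_partial_reward:
  "\<alpha> > 0 \<Longrightarrow> bounded_weak_partial i (reward \<alpha>) (reward_grad \<alpha> i)"
  unfolding bounded_weak_partial_def
  by (simp add: reward_grad_measurable reward_grad_bounded weak_partial_reward)

definition reward_hess :: "real \<Rightarrow> 2 \<Rightarrow> 2 \<Rightarrow> (real^2) set \<Rightarrow> real" where
  "reward_hess \<alpha> i j =
     sr_scale (\<lambda>x. normal_vec \<alpha> $ i * normal_vec \<alpha> $ j / sqrt (1 + \<alpha>\<^sup>2)) (sr_of (arc_length \<alpha>))"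

lemma measure_second_partial_reward:
  assumes \<alpha>: "\<alpha> > 0"
  shows "measure_second_partial i j (reward \<alpha>) (reward_hess \<alpha> i j)"
  unfolding measure_second_partial_def
proof (intro conjI allI impI)
  show "signed_radon (reward_hess \<alpha> i j)"
    unfolding reward_hess_def by (intro signed_radon_scale radon_arc_length \<alpha>) simp
  fix \<phi> assume \<phi>: "test_fun \<phi>"
  have "1 + \<alpha>\<^sup>2 > 0"
    by (simp add: add_pos_nonneg)
  then have "sr_integral (reward_hess \<alpha> i j) \<phi> =
      normal_vec \<alpha> $ i * normal_vec \<alpha> $ j * (LINT t|lborel. \<phi> (vector [\<alpha> * t, t]))"
    unfolding reward_hess_def
    by (simp add: sr_integral_scale_test_fun[OF radon_arc_length[OF \<alpha>] loc_bounded_const \<phi>]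
        integral_arc_length_test_fun[OF \<alpha> \<phi>])
  also have "\<dots> = (LINT x|leb. reward \<alpha> x * partial i (partial j \<phi>) x)"
    \<comment> \<open>The first-order formula is applied to the test function
      \<open>partial j \<phi>\<close>; the minus signs of the two integrations by parts
      cancel.\<close>
    using integral_reward_grad_partial[OF \<alpha> \<phi>, of i j]
      weak_partial_reward[OF \<alpha> test_fun_partial[OF \<phi>, of j], of i] by simp
  finally show "sr_integral (reward_hess \<alpha> i j) \<phi> = (LINT x|leb. reward \<alpha> x * partial i (partial j \<phi>) x)" .
qed

section \<open>Linear dependence of a signed measure on its density\<close>

lemma sr_scale_add:
  assumes "radon M" "loc_bounded f" "loc_bounded g"
  shows "sr_scale (\<lambda>x. f x + g x) (sr_of M) A = sr_scale f (sr_of M) A + sr_scale g (sr_of M) A"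
proof (cases "A \<in> rel_compact")
  case True
  then show ?thesis
    using assms by (simp add: sr_scale_sr_of loc_bounded_add distrib_left integrable_indicator_mult)
qed (simp add: sr_scale_def)

lemma sr_scale_uminus:
  assumes "radon M" "loc_bounded f"
  shows "sr_scale (\<lambda>x. - f x) (sr_of M) A = - sr_scale f (sr_of M) A"
proof (cases "A \<in> rel_compact")
  case True
  then show ?thesis
    using assms by (simp add: sr_scale_sr_of loc_bounded_uminus)
qed (simp add: sr_scale_def)

lemma sr_scale_diff:
  assumes "radon M" "loc_bounded f" "loc_bounded g"
  shows "sr_scale (\<lambda>x. f x - g x) (sr_of M) A = sr_scale f (sr_of M) A - sr_scale g (sr_of M) A"
  using sr_scale_add[OF assms(1,2) loc_bounded_uminus[OF assms(3)]] sr_scale_uminus[OF assms(1,3)] by simp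

lemma sr_scale_cong_AE:
  assumes M: "radon M" and fg: "loc_bounded f" "loc_bounded g" and eq: "AE x in M. f x = g x"
  shows "sr_scale f (sr_of M) A = sr_scale g (sr_of M) A"
proof (cases "A \<in> rel_compact")
  case True
  have "(LINT x|M. indicator A x * f x) = (LINT x|M. indicator A x * g x)"
  proof (rule integral_cong_AE)
    show "AE x in M. indicator A x * f x = indicator A x * g x"
      using eq by eventually_elim simp
  qed (use integrable_indicator_mult[OF M fg(1) True] integrable_indicator_mult[OF M fg(2) True] in simp_all)
  then show ?thesis
    using M fg True by (simp add: sr_scale_sr_of)
qed (simp add: sr_scale_def)

lemma loc_bounded_cong:
  assumes "loc_bounded f" "\<And>x. x \<in> opq \<Longrightarrow> f x = g x"
  shows "loc_bounded g"
  unfolding loc_bounded_def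
proof (intro conjI allI impI)
  have "f \<in> borel_measurable opq_borel \<longleftrightarrow> g \<in> borel_measurable opq_borel"
    using assms(2) by (intro measurable_cong) (simp add: space_restrict_space)
  then show "g \<in> borel_measurable opq_borel"
    using assms(1) by (simp add: loc_bounded_def)
  fix K assume K: "compact K \<and> K \<subseteq> opq"
  then have "g ` K = f ` K"
    using assms(2) by (intro image_cong) auto
  then show "bounded (g ` K)"
    using assms(1) K by (simp add: loc_bounded_def)
qed

lemma AE_leb_off_diagonal: "AE x in leb. x \<notin> diagonal \<alpha>"
proof -
  have "diagonal \<alpha> = {x. normal_vec \<alpha> \<bullet> x = 0}"
    by (auto simp: diagonal_def inner_vec_def sum_2 normal_vec_component)
  moreover have "normal_vec \<alpha> \<noteq> 0"
    using normal_vec_component(1)[of \<alpha>] by auto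
  ultimately have "negligible (diagonal \<alpha>)"
    by (simp add: negligible_hyperplane)
  then have "AE x in lebesgue. x \<notin> diagonal \<alpha>"
    by (simp add: negligible_iff_null_sets AE_not_in)
  then have "AE x in lborel. x \<notin> diagonal \<alpha>"
    by (simp add: AE_completion_iff)
  then show ?thesis
    unfolding leb_def by (subst AE_restrict_space_iff) auto
qed

section \<open>The quadratic form q and the normal vector\<close>

lemma diffusion_nth: "diffusion \<sigma> x $ i $ j = \<sigma> x $ i $ 1 * \<sigma> x $ j $ 1 + \<sigma> x $ i $ 2 * \<sigma> x $ j $ 2"
  by (simp add: diffusion_def matrix_matrix_mult_def transpose_def sum_2)

lemma q_form_expand:
  "q_form \<alpha> \<sigma> x =
    diffusion \<sigma> x $ 1 $ 1 - 2 * \<alpha> * diffusion \<sigma> x $ 1 $ 2 + \<alpha>\<^sup>2 * diffusion \<sigma> x $ 2 $ 2"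
proof -
  have "q_form \<alpha> \<sigma> x = diffusion \<sigma> x $ 1 $ 1 - \<alpha> * diffusion \<sigma> x $ 1 $ 2
      - \<alpha> * diffusion \<sigma> x $ 2 $ 1 + \<alpha>\<^sup>2 * diffusion \<sigma> x $ 2 $ 2"
    by (simp add: q_form_def inner_vec_def matrix_vector_mult_def sum_2 normal_vec_component
        algebra_simps power2_eq_square)
  moreover have "diffusion \<sigma> x $ 2 $ 1 = diffusion \<sigma> x $ 1 $ 2"
    by (simp add: diffusion_nth mult.commute)
  ultimately show ?thesis by simp
qed

text \<open>Since a is \<sigma> times its transpose, q is the squared length of the transpose of
  \<sigma> applied to n; the two squares are its components.\<close>

lemma q_form_nonneg: "q_form \<alpha> \<sigma> x \<ge> 0"
proof -
  have "q_form \<alpha> \<sigma> x = (\<sigma> x $ 1 $ 1 - \<alpha> * \<sigma> x $ 2 $ 1)\<^sup>2 + (\<sigma> x $ 1 $ 2 - \<alpha> * \<sigma> x $ 2 $ 2)\<^sup>2"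
    unfolding q_form_expand diffusion_nth by (simp add: algebra_simps power2_eq_square)
  then show ?thesis by simp
qed

text \<open>Ellipticity on the compact set \<open>{x}\<close> in the direction n gives q \<ge> l
  |n|^2, and n is nonzero because its first component is 1.\<close>

lemma q_form_pos:
  assumes "loc_unif_elliptic clq (diffusion \<sigma>)" "x \<in> clq"
  shows "q_form \<alpha> \<sigma> x > 0"
proof -
  have "compact {x} \<and> {x} \<subseteq> clq"
    using assms(2) by simp
  then obtain l where l: "l > 0" "\<forall>y\<in>{x}. \<forall>\<xi>. \<xi> \<bullet> (diffusion \<sigma> y *v \<xi>) \<ge> l * (norm \<xi>)\<^sup>2"
    using assms(1) unfolding loc_unif_elliptic_def by blast
  have "norm (normal_vec \<alpha>) > 0"
    using normal_vec_component(1)[of \<alpha>] by auto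
  then have "0 < l * (norm (normal_vec \<alpha>))\<^sup>2"
    using l(1) by simp
  also have "\<dots> \<le> q_form \<alpha> \<sigma> x"
    using l(2) by (simp add: q_form_def)
  finally show ?thesis .
qed

lemma norm_normal_vec: "norm (normal_vec \<alpha>) = sqrt (1 + \<alpha>\<^sup>2)"
  by (simp add: norm_eq_sqrt_inner inner_vec_def sum_2 normal_vec_component power2_eq_square)

lemma lin_Y_has_derivative: "(lin_Y \<alpha> has_derivative (\<lambda>h. normal_vec \<alpha> \<bullet> h)) (at x)"
proof -
  have "lin_Y \<alpha> = (\<lambda>h. normal_vec \<alpha> \<bullet> h)"
    by (simp add: fun_eq_iff lin_Y_def inner_vec_def sum_2 normal_vec_component)
  then show ?thesis
    by (simp add: bounded_linear_imp_has_derivative bounded_linear_inner_right)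
qed

lemma loc_lipschitz_on_continuous: "loc_lipschitz_on X f \<Longrightarrow> continuous_on X f"
  unfolding loc_lipschitz_on_def by (rule local_lipschitz_continuous_on[of UNIV X "\<lambda>_. f" 0]) simp_all

subsection \<open>The stopping gain\<close>

lemma loc_bounded_diffusion:
  assumes "loc_lipschitz_on clq \<sigma>"
  shows "loc_bounded (\<lambda>x. diffusion \<sigma> x $ i $ j)"
proof -
  have "continuous_on opq \<sigma>"
    using loc_lipschitz_on_continuous[OF assms]
    by (rule continuous_on_subset) (auto simp: opq_def clq_def)
  then show ?thesis
    unfolding diffusion_nth by (intro loc_bounded_continuous continuous_intros)
qed

lemma loc_bounded_q_form:
  assumes "loc_lipschitz_on clq \<sigma>"
  shows "loc_bounded (q_form \<alpha> \<sigma>)"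
proof -
  note d = loc_bounded_diffusion[OF assms]
  have "loc_bounded (\<lambda>x. diffusion \<sigma> x $ 1 $ 1 - 2 * \<alpha> * diffusion \<sigma> x $ 1 $ 2 +
      \<alpha>\<^sup>2 * diffusion \<sigma> x $ 2 $ 2)"
    by (intro loc_bounded_add loc_bounded_diff loc_bounded_mult d loc_bounded_const)
  then show ?thesis
    by (simp flip: q_form_expand)
qed

text \<open>The density of the absolutely continuous part of the generator applied to the reward: G
  is linear on either side of \<Delta>, so the second-order terms contribute only to the singular
  part.\<close>

definition drift_part :: "real \<Rightarrow> (real^2 \<Rightarrow> real^2) \<Rightarrow> real^2 \<Rightarrow> real" where
  "drift_part \<alpha> \<mu> x = \<mu> x $ 1 * reward_grad \<alpha> 1 x + \<mu> x $ 2 * reward_grad \<alpha> 2 x"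

lemma gamma_ac_off_diagonal:
  assumes "x \<notin> diagonal \<alpha>"
  shows "gamma_ac \<alpha> r c \<mu> \<sigma> x = c x + r * reward \<alpha> x - drift_part \<alpha> \<mu> x"
proof -
  consider "x $ 1 > \<alpha> * x $ 2" | "x $ 1 < \<alpha> * x $ 2"
    using assms unfolding diagonal_def by fastforce
  then show ?thesis
  proof cases
    case 1
    show ?thesis
      unfolding gamma_ac_R1[OF 1] using 1 by (simp add: drift_part_def reward_grad_def reward_def)
  next
    case 2
    show ?thesis
      unfolding gamma_ac_R2[OF 2] using 2 by (simp add: drift_part_def reward_grad_def reward_def)
  qed
qed

theorem theorem3p1:
  fixes \<alpha> r :: real
    and c :: "real^2 \<Rightarrow> real"
    and \<mu> :: "real^2 \<Rightarrow> real^2"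
    and \<sigma> :: "real^2 \<Rightarrow> real^2^2"
  assumes "\<alpha> > 0" and "r > 0"
    and "continuous_on clq c" and "\<And>x. x \<in> clq \<Longrightarrow> c x \<ge> 0"
    and "loc_lipschitz_on clq \<mu>" and "linear_growth_on clq \<mu>"
    and "loc_lipschitz_on clq \<sigma>" and "linear_growth_on clq \<sigma>"
    and "loc_unif_elliptic clq (diffusion \<sigma>)"
  shows "(\<forall>x. (lin_Y \<alpha> has_derivative (\<lambda>h. normal_vec \<alpha> \<bullet> h)) (at x)) \<and>
    norm (normal_vec \<alpha>) = sqrt (1 + \<alpha>\<^sup>2) \<and>
    (\<forall>x\<in>clq. q_form \<alpha> \<sigma> x =
       diffusion \<sigma> x $ 1 $ 1 - 2 * \<alpha> * diffusion \<sigma> x $ 1 $ 2 + \<alpha>\<^sup>2 * diffusion \<sigma> x $ 2 $ 2) \<and>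
    (\<exists>!\<Lambda>. is_distr_generator \<mu> \<sigma> (reward \<alpha>) \<Lambda>) \<and>
    signed_radon (stopping_gain \<alpha> r c \<mu> \<sigma>) \<and>
    (\<exists>\<Gamma>\<Delta>. signed_radon \<Gamma>\<Delta> \<and>
       (\<forall>A. stopping_gain \<alpha> r c \<mu> \<sigma> A = sr_scale (gamma_ac \<alpha> r c \<mu> \<sigma>) (sr_of leb) A + \<Gamma>\<Delta> A) \<and>
       \<Gamma>\<Delta> = sr_scale (\<lambda>x. - q_form \<alpha> \<sigma> x / (2 * sqrt (1 + \<alpha>\<^sup>2))) (sr_of (arc_length \<alpha>)) \<and>
       (\<forall>F. F \<in> borel_measurable (restrict_space borel opq) \<and> bounded (F ` opq) \<longrightarrow>
          (sr_integrable \<Gamma>\<Delta> F \<longleftrightarrow> integrable (arc_length \<alpha>) (\<lambda>x. F x * q_form \<alpha> \<sigma> x)) \<and>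
          (sr_integrable \<Gamma>\<Delta> F \<longrightarrow> sr_integral \<Gamma>\<Delta> F =
             - (1 / (2 * sqrt (1 + \<alpha>\<^sup>2))) * (LINT x|arc_length \<alpha>. F x * q_form \<alpha> \<sigma> x))) \<and>
       (\<forall>A. \<Gamma>\<Delta> A \<le> 0)) \<and>
    (\<forall>x\<in>clq. q_form \<alpha> \<sigma> x \<ge> 0) \<and>
    (\<forall>x \<in> diagonal \<alpha> \<inter> clq. invertible (diffusion \<sigma> x) \<longrightarrow>
       q_form \<alpha> \<sigma> x > 0 \<and> - q_form \<alpha> \<sigma> x / (2 * sqrt (1 + \<alpha>\<^sup>2)) < 0)"
proof -
  define R where "R = sqrt (1 + \<alpha>\<^sup>2)"
  have R: "R > 0"
    unfolding R_def by (simp add: add_pos_nonneg)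
  note leb = radon_leb and arc = radon_arc_length[OF assms(1)]
  have sub: "opq \<subseteq> clq"
    by (auto simp: opq_def clq_def)
  have lb_\<mu>: "loc_bounded (\<lambda>x. \<mu> x $ i)" for i
    using continuous_on_subset[OF loc_lipschitz_on_continuous[OF assms(5)] sub]
    by (intro loc_bounded_continuous continuous_intros)
  have lb_c: "loc_bounded c"
    by (rule loc_bounded_continuous) (rule continuous_on_subset[OF assms(3) sub])
  note lb_a = loc_bounded_diffusion[OF assms(7)] and lb_q = loc_bounded_q_form[OF assms(7), of \<alpha>]
  define h where "h = (\<lambda>x. - q_form \<alpha> \<sigma> x / (2 * R))"
  have h_eq: "h = (\<lambda>x. - (1 / (2 * R)) * q_form \<alpha> \<sigma> x)"
    by (simp add: h_def)
  have lb_h: "loc_bounded h"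
    unfolding h_eq by (intro loc_bounded_mult loc_bounded_const lb_q)
  have h_nonpos: "h x \<le> 0" for x
    using R q_form_nonneg[of \<alpha> \<sigma> x] by (simp add: h_def)
  have lb_drift: "loc_bounded (\<lambda>x. \<mu> x $ i * reward_grad \<alpha> i x)" for i
    by (intro loc_bounded_mult lb_\<mu> loc_bounded_reward_grad)
  define \<Lambda> where "\<Lambda> A = (\<Sum>i\<in>UNIV. sr_scale (\<lambda>x. \<mu> x $ i * reward_grad \<alpha> i x) (sr_of leb) A) +
      (\<Sum>i\<in>UNIV. \<Sum>j\<in>UNIV. sr_scale (\<lambda>x. 1/2 * diffusion \<sigma> x $ i $ j) (reward_hess \<alpha> i j) A)" for A
  have gen: "is_distr_generator \<mu> \<sigma> (reward \<alpha>) \<Lambda>"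
    unfolding is_distr_generator_def
    by (intro exI[of _ "reward_grad \<alpha>"] exI[of _ "reward_hess \<alpha>"] conjI allI
        bounded_weak_partial_reward measure_second_partial_reward assms(1) \<Lambda>_def)
  have ex1: "\<exists>!\<Lambda>. is_distr_generator \<mu> \<sigma> (reward \<alpha>) \<Lambda>"
    using gen is_distr_generator_unique[OF leb lb_\<mu>] by blast
  have distr: "distr_generator \<mu> \<sigma> (reward \<alpha>) = \<Lambda>"
    unfolding distr_generator_def
  proof (rule the_equality)
    show "is_distr_generator \<mu> \<sigma> (reward \<alpha>) \<Lambda>"
      by (rule gen)
    show "\<Lambda>' = \<Lambda>" if "is_distr_generator \<mu> \<sigma> (reward \<alpha>) \<Lambda>'" for \<Lambda>'
      by (rule is_distr_generator_unique[OF leb lb_\<mu> that gen])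
  qed
  have hess: "sr_scale (\<lambda>x. 1/2 * diffusion \<sigma> x $ i $ j) (reward_hess \<alpha> i j) =
      sr_scale (\<lambda>x. 1/2 * diffusion \<sigma> x $ i $ j * (normal_vec \<alpha> $ i * normal_vec \<alpha> $ j / R)) (sr_of (arc_length \<alpha>))"
    for i j
    unfolding reward_hess_def R_def[symmetric]
    by (intro sr_scale_sr_scale arc loc_bounded_mult loc_bounded_const lb_a)
  have \<Lambda>_eq: "\<Lambda> A = sr_scale (drift_part \<alpha> \<mu>) (sr_of leb) A - sr_scale h (sr_of (arc_length \<alpha>)) A" for A
  proof -
    define k where "k i j x = 1/2 * diffusion \<sigma> x $ i $ j * (normal_vec \<alpha> $ i * normal_vec \<alpha> $ j / R)" for i j x
    have lb_k: "loc_bounded (k i j)" for i j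
      unfolding k_def by (intro loc_bounded_mult loc_bounded_const lb_a)
    \<comment> \<open>Contracting a / 2 with n_i n_j / |n| gives q / (2 |n|). Symmetry of a merges
      the two mixed terms into the doubled one of \<open>q_form_expand\<close>.\<close>
    have sum_k: "k 1 1 x + k 1 2 x + (k 2 1 x + k 2 2 x) = - h x" for x
    proof -
      have "diffusion \<sigma> x $ 2 $ 1 = diffusion \<sigma> x $ 1 $ 2"
        by (simp add: diffusion_nth mult.commute)
      then show ?thesis
        using R by (simp add: k_def h_def q_form_expand normal_vec_component field_simps power2_eq_square)
    qed
    have "(\<Sum>i\<in>UNIV. \<Sum>j\<in>UNIV. sr_scale (\<lambda>x. 1/2 * diffusion \<sigma> x $ i $ j) (reward_hess \<alpha> i j) A) =
        sr_scale (\<lambda>x. k 1 1 x + k 1 2 x + (k 2 1 x + k 2 2 x)) (sr_of (arc_length \<alpha>)) A"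
      unfolding hess k_def[symmetric] sum_2
      by (simp add: sr_scale_add[OF arc] loc_bounded_add lb_k)
    also have "\<dots> = - sr_scale h (sr_of (arc_length \<alpha>)) A"
      unfolding sum_k by (rule sr_scale_uminus[OF arc lb_h])
    finally show ?thesis
      unfolding \<Lambda>_def drift_part_def[abs_def] sum_2 by (simp add: sr_scale_add[OF leb lb_drift lb_drift])
  qed
  have lb_drift_part: "loc_bounded (drift_part \<alpha> \<mu>)"
    unfolding drift_part_def[abs_def] by (intro loc_bounded_add lb_drift)
  have lb_cr: "loc_bounded (\<lambda>x. c x + r * reward \<alpha> x)"
    by (intro loc_bounded_add loc_bounded_mult loc_bounded_const lb_c loc_bounded_reward)
  \<comment> \<open>\<open>gamma_ac\<close> is 0 on \<Delta> by convention, so it is this indicator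
    times a locally bounded function.\<close>
  have off: "loc_bounded (\<lambda>x. indicator (- diagonal \<alpha>) x)"
  proof (rule loc_bounded_bounded)
    have "diagonal \<alpha> \<in> sets borel"
      unfolding diagonal_def by measurable
    then show "(\<lambda>x. indicator (- diagonal \<alpha>) x :: real) \<in> borel_measurable opq_borel"
      by (intro measurable_restrict_space1) simp
    show "bounded ((\<lambda>x. indicator (- diagonal \<alpha>) x :: real) ` opq)"
      unfolding bounded_iff by (rule exI[of _ 1]) (auto split: split_indicator)
  qed
  have lb_ac: "loc_bounded (gamma_ac \<alpha> r c \<mu> \<sigma>)"
  proof (rule loc_bounded_cong)
    show "loc_bounded (\<lambda>x. indicator (- diagonal \<alpha>) x * (c x + r * reward \<alpha> x - drift_part \<alpha> \<mu> x))"
      by (intro loc_bounded_mult loc_bounded_diff off lb_cr lb_drift_part)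
    show "indicator (- diagonal \<alpha>) x * (c x + r * reward \<alpha> x - drift_part \<alpha> \<mu> x) = gamma_ac \<alpha> r c \<mu> \<sigma> x" for x
      by (cases "x \<in> diagonal \<alpha>") (simp_all add: gamma_ac_off_diagonal, simp add: gamma_ac_def)
  qed
  have ac: "sr_scale (gamma_ac \<alpha> r c \<mu> \<sigma>) (sr_of leb) A =
      sr_scale (\<lambda>x. c x + r * reward \<alpha> x) (sr_of leb) A - sr_scale (drift_part \<alpha> \<mu>) (sr_of leb) A" for A
  proof -
    have "AE x in leb. gamma_ac \<alpha> r c \<mu> \<sigma> x = c x + r * reward \<alpha> x - drift_part \<alpha> \<mu> x"
      using AE_leb_off_diagonal[of \<alpha>] by eventually_elim (rule gamma_ac_off_diagonal)
    then have "sr_scale (gamma_ac \<alpha> r c \<mu> \<sigma>) (sr_of leb) A =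
        sr_scale (\<lambda>x. c x + r * reward \<alpha> x - drift_part \<alpha> \<mu> x) (sr_of leb) A"
      by (intro sr_scale_cong_AE leb lb_ac loc_bounded_diff lb_cr lb_drift_part)
    also have "\<dots> = sr_scale (\<lambda>x. c x + r * reward \<alpha> x) (sr_of leb) A - sr_scale (drift_part \<alpha> \<mu>) (sr_of leb) A"
      by (rule sr_scale_diff[OF leb lb_cr lb_drift_part])
    finally show ?thesis .
  qed
  \<comment> \<open>The generator contains minus the measure with density \<open>h\<close>, and the
    gain subtracts the generator, so that measure enters with a plus sign.\<close>
  have gain: "stopping_gain \<alpha> r c \<mu> \<sigma> A =
      sr_scale (gamma_ac \<alpha> r c \<mu> \<sigma>) (sr_of leb) A + sr_scale h (sr_of (arc_length \<alpha>)) A" for A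
    unfolding stopping_gain_def distr \<Lambda>_eq ac by simp
  have sr_h: "signed_radon (sr_scale h (sr_of (arc_length \<alpha>)))"
    by (rule signed_radon_scale[OF arc lb_h])
  have "signed_radon (\<lambda>A. sr_scale (gamma_ac \<alpha> r c \<mu> \<sigma>) (sr_of leb) A + sr_scale h (sr_of (arc_length \<alpha>)) A)"
    by (intro signed_radon_add signed_radon_scale leb lb_ac sr_h)
  then have sr_gain: "signed_radon (stopping_gain \<alpha> r c \<mu> \<sigma>)"
    by (simp flip: gain)
  have hF: "(\<lambda>x. h x * F x) = (\<lambda>x. - (1 / (2 * R)) * (F x * q_form \<alpha> \<sigma> x))" for F
    by (simp add: h_def fun_eq_iff)
  have F_integrable: "sr_integrable (sr_scale h (sr_of (arc_length \<alpha>))) F \<longleftrightarrow>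
      integrable (arc_length \<alpha>) (\<lambda>x. F x * q_form \<alpha> \<sigma> x)"
    if "F \<in> borel_measurable opq_borel" for F
    \<comment> \<open>The densities \<open>h\<close> and q differ by a nonzero constant factor, so
      integrability against one is integrability against the other; the sign of \<open>h\<close> is
      what makes this an equivalence.\<close>
    unfolding sr_integrable_scale_nonpos_iff[OF arc lb_h h_nonpos that] hF
    using R by (subst integrable_mult_left_iff) simp
  have F_integral: "sr_integral (sr_scale h (sr_of (arc_length \<alpha>))) F =
      - (1 / (2 * R)) * (LINT x|arc_length \<alpha>. F x * q_form \<alpha> \<sigma> x)"
    if F: "F \<in> borel_measurable opq_borel" and i: "integrable (arc_length \<alpha>) (\<lambda>x. F x * q_form \<alpha> \<sigma> x)" for F
  proof -
    have "integrable (arc_length \<alpha>) (\<lambda>x. h x * F x)"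
      unfolding hF by (intro Bochner_Integration.integrable_mult_right i)
    then have "sr_integral (sr_scale h (sr_of (arc_length \<alpha>))) F = (LINT x|arc_length \<alpha>. h x * F x)"
      by (rule sr_integral_scale[OF arc lb_h F])
    then show ?thesis
      unfolding hF by simp
  qed
  have nonpos: "sr_scale h (sr_of (arc_length \<alpha>)) A \<le> 0" for A
  proof (cases "A \<in> rel_compact")
    case True
    have "0 \<le> (LINT x|arc_length \<alpha>. - (indicator A x * h x))"
      using h_nonpos by (intro Bochner_Integration.integral_nonneg) (simp add: mult_nonneg_nonpos)
    then show ?thesis
      by (simp add: sr_scale_sr_of[OF arc lb_h True])
  qed (simp add: sr_scale_def)
  have strict: "q_form \<alpha> \<sigma> x > 0 \<and> - q_form \<alpha> \<sigma> x / (2 * R) < 0" if "x \<in> clq" for x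
    using q_form_pos[OF assms(9) that, of \<alpha>] R by simp
  show ?thesis
    unfolding R_def[symmetric] h_def[symmetric]
    using lin_Y_has_derivative norm_normal_vec[of \<alpha>, folded R_def] q_form_expand ex1 sr_gain sr_h gain
      F_integrable F_integral nonpos q_form_nonneg strict
    by (intro conjI exI[of _ "sr_scale h (sr_of (arc_length \<alpha>))"] ballI allI impI)
      blast+
qed

end
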